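(* There exists a finite simple 3-connected planar graph $G$ that is not prism-hamiltonian, i.e. such that the prism $G\Box K_2$ has no Hamilton cycle. (Equivalently, the conjecture of Rosenfeld and Barnette that every 3-connected planar graph is prism-hamiltonian is false.)
   Context: Graphs are finite and simple. The Cartesian product $G\Box H$ of graphs $G$ and $H$ has vertex set $V(G)\times V(H)$, where $(x_1,y_1)$ and $(x_2,y_2)$ are adjacent if either $x_1x_2\in E(G)$ and $y_1=y_2$, or $x_1=x_2$ and $y_1y_2\in E(H)$. The prism over $G$ is $G\Box K_2$, where $K_2$ is the complete graph on two vertices. A Hamilton cycle in a graph is a spanning cycle; a graph is hamiltonian if it has a Hamilton cycle. A graph $G$ is prism-hamiltonian if the prism $G\Box K_2$ is hamiltonian. *)

theory Defs
  imports "HOL-Analysis.Analysis" "Graph_Theory.Graph_Theory"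
begin

text \<open>A finite simple graph is a \<^locale>\<open>pair_graph\<close>: finite, loop-free and symmetric, so each
  undirected edge \<open>uv\<close> is present as the two arcs \<open>(u, v)\<close> and \<open>(v, u)\<close>.\<close>

definition cartesian_product ::
    "'a pair_pre_digraph \<Rightarrow> 'b pair_pre_digraph \<Rightarrow> ('a \<times> 'b) pair_pre_digraph" where
  "cartesian_product G H =
    \<lparr> pverts = pverts G \<times> pverts H,
      parcs = {((x\<^sub>1, y\<^sub>1), (x\<^sub>2, y\<^sub>2)) | x\<^sub>1 y\<^sub>1 x\<^sub>2 y\<^sub>2.
        (x\<^sub>1, x\<^sub>2) \<in> parcs G \<and> y\<^sub>1 = y\<^sub>2 \<and> y\<^sub>1 \<in> pverts H \<or>
        x\<^sub>1 = x\<^sub>2 \<and> x\<^sub>1 \<in> pverts G \<and> (y\<^sub>1, y\<^sub>2) \<in> parcs H} \<rparr>"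

definition K2 :: "bool pair_pre_digraph" where
  "K2 = \<lparr> pverts = {False, True}, parcs = {(False, True), (True, False)} \<rparr>"

lemma complete_digraph_K2: "complete_digraph 2 (with_proj K2)"
  by (auto simp: complete_digraph_pair_def K2_def)

lemma pair_graph_K2: "pair_graph K2"
  by (rule pair_graphI_complete[OF complete_digraph_K2])

lemma pair_graph_cartesian_product:
  assumes "pair_graph G" "pair_graph H"
  shows "pair_graph (cartesian_product G H)"
proof -
  interpret G: pair_graph G by fact
  interpret H: pair_graph H by fact
  let ?P = "cartesian_product G H"
  have sub: "parcs ?P \<subseteq> pverts ?P \<times> pverts ?P"
    unfolding cartesian_product_def
    by (auto dest: G.in_arcsD1 G.in_arcsD2 H.in_arcsD1 H.in_arcsD2)
  have fin: "finite (pverts ?P)"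
    by (simp add: cartesian_product_def)
  have sym: "(b, a) \<in> parcs ?P" if "(a, b) \<in> parcs ?P" for a b
    using that G.arcs_symmetric H.arcs_symmetric by (auto simp: cartesian_product_def)
  show ?thesis
  proof
    show "finite (parcs ?P)"
      using finite_subset[OF sub] fin by blast
    show "symmetric (with_proj ?P)"
      using sym by (auto simp: symmetric_def intro: symI)
    show "fst e \<noteq> snd e" if "e \<in> parcs ?P" for e
      using that G.no_loops H.no_loops by (fastforce simp: cartesian_product_def)
  qed (use sub fin in auto)
qed

text \<open>The library's \<^const>\<open>pre_digraph.cycle\<close> also accepts the closed walk \<open>u, v, u\<close> along one
  undirected edge; the length bound excludes it.\<close>

definition hamilton_cycle :: "'a pair_pre_digraph \<Rightarrow> ('a \<times> 'a) awalk \<Rightarrow> bool" where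
  "hamilton_cycle G p \<longleftrightarrow>
    pre_digraph.cycle (with_proj G) p \<and> 3 \<le> length p \<and> fst ` set p = pverts G"

definition hamiltonian :: "'a pair_pre_digraph \<Rightarrow> bool" where
  "hamiltonian G \<longleftrightarrow> (\<exists>p. hamilton_cycle G p)"

definition prism :: "'a pair_pre_digraph \<Rightarrow> ('a \<times> bool) pair_pre_digraph" where
  "prism G = cartesian_product G K2"

definition prism_hamiltonian :: "'a pair_pre_digraph \<Rightarrow> bool" where
  "prism_hamiltonian G \<longleftrightarrow> hamiltonian (prism G)"

definition k_connected :: "nat \<Rightarrow> 'a pair_pre_digraph \<Rightarrow> bool" where
  "k_connected k G \<longleftrightarrow> k < card (pverts G) \<and>
    (\<forall>S \<subseteq> pverts G. card S < k \<longrightarrow>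
      Digraph_Component.connected (with_proj G \<restriction> (pverts G - S)))"

text \<open>A drawing in the plane places the vertices at distinct points and represents each edge by a
  simple arc between its ends, the two orientations of an edge sharing the same point set. An arc
  meets no vertex other than its ends, and two different edges meet only in common ends.\<close>

definition plane_drawing ::
    "'a pair_pre_digraph \<Rightarrow> ('a \<Rightarrow> real \<times> real) \<Rightarrow> ('a \<times> 'a \<Rightarrow> real \<Rightarrow> real \<times> real) \<Rightarrow> bool" where
  "plane_drawing G pos \<gamma> \<longleftrightarrow>
    inj_on pos (pverts G) \<and>
    (\<forall>(u, v) \<in> parcs G.
      arc (\<gamma> (u, v)) \<and> pathstart (\<gamma> (u, v)) = pos u \<and> pathfinish (\<gamma> (u, v)) = pos v \<and>
      path_image (\<gamma> (v, u)) = path_image (\<gamma> (u, v)) \<and>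
      (\<forall>w \<in> pverts G. pos w \<in> path_image (\<gamma> (u, v)) \<longrightarrow> w \<in> {u, v})) \<and>
    (\<forall>(u, v) \<in> parcs G. \<forall>(x, y) \<in> parcs G. {u, v} \<noteq> {x, y} \<longrightarrow>
      path_image (\<gamma> (u, v)) \<inter> path_image (\<gamma> (x, y)) \<subseteq> pos ` ({u, v} \<inter> {x, y}))"

definition planar :: "'a pair_pre_digraph \<Rightarrow> bool" where
  "planar G \<longleftrightarrow> (\<exists>pos \<gamma>. plane_drawing G pos \<gamma>)"

end

theory Submission
  imports Defs
begin

text \<open>The counterexample is built in the spirit of Spacapan's: a tight toughness count is combined with
small pieces that a Hamilton cycle of the prism cannot traverse in the way the count would force.

Delete from a graph a set \<open>S\<close> of vertices. A Hamilton cycle of the prism loses the \<open>2 * card S\<close> copies of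
the vertices of \<open>S\<close> and has at most \<open>4 * card S\<close> edges at them, while it needs at least two edges to
enter and leave each component of the rest. In a plane triangulation with one component in each
face the two quantities differ by a constant only, so a few components that need four edges
instead of two already give a contradiction.

The basic piece is a \<^emph>\<open>spider\<close>: a centre \<open>s\<close> with legs \<open>a\<close>, \<open>b\<close> and \<open>c - d\<close>, put into a triangle
\<open>x y z\<close> so that every vertex has degree three. If the cycle runs through a spider only once, it
cannot both enter and leave it through \<open>x\<close> (lemma \<open>spider_crossings\<close>): removing \<open>s\<close> cuts the spider into three
pieces, which forces the order in which they are visited, and counting the changes of layer shows
that the cycle would leave through the very copy of \<open>x\<close> through which it entered, and so close up
too early. A \<^emph>\<open>cell\<close> is a triangle with a centre \<open>t\<close> joined to its three corners and a spider in each of the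
three resulting triangles, with \<open>t\<close> in the role of \<open>x\<close>. The two copies of \<open>t\<close> are ends of four edges
of the cycle in all, counted with multiplicity, but three spiders that are traversed once supply at
most three of them. This forces at least four edges of the cycle to run between the cell and its corners (lemma \<open>cell_crossings\<close>).

The graph consists of a triangulation with six vertices, the \<^emph>\<open>frame\<close>, and a cell in each of its seven
bounded faces. Cells would need \<open>7 * 4 = 28\<close> edges at copies of frame vertices, but these have
only \<open>6 * 2 * 2 = 24\<close>. Hence the prism has no Hamilton cycle.

For three-connectedness, every vertex of a spider has three paths to \<open>x\<close>, \<open>y\<close>, \<open>z\<close> that are disjoint apart from
their start, and two deleted vertices cannot meet all three; so whatever remains is linked to the
frame, which stays connected itself. For planarity, a single straight-line drawing of a cell on an
integer grid is checked pair of edges by pair of edges, and seven affine copies of it are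
placed into the bounded triangles of a drawing of the frame.\<close>

section \<open>The edges of a Hamilton cycle of a prism\<close>

text \<open>The edges of a Hamilton cycle of the prism over \<open>(V, E)\<close>, as indicator functions: \<open>h i u v\<close> tells whether
the copy of \<open>uv\<close> in layer \<open>i\<close> is used, and \<open>r u\<close> whether the rung joining the two copies of \<open>u\<close> is used.
They are numbers so that the arguments below become linear arithmetic. Being a single cycle is
expressed by the last assumption: the cycle leaves every nonempty proper set of vertices.\<close>

locale prism_two_factor =
  fixes V :: "'a set" and E :: "('a \<times> 'a) set"
    and h :: "bool \<Rightarrow> 'a \<Rightarrow> 'a \<Rightarrow> nat" and r :: "'a \<Rightarrow> nat"
  assumes finite_V: "finite V"
    and E_V: "(u, v) \<in> E \<Longrightarrow> u \<in> V \<and> v \<in> V"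
    and h_le: "h i u v \<le> 1"
    and r_le: "r u \<le> 1"
    and h_sym: "h i u v = h i v u"
    and h_E: "h i u v \<noteq> 0 \<Longrightarrow> (u, v) \<in> E"
    and degree: "u \<in> V \<Longrightarrow> (\<Sum>v\<in>V. h i u v) + r u = 2"
    and leaves: "W \<subseteq> V \<times> UNIV \<Longrightarrow> W \<noteq> {} \<Longrightarrow> W \<noteq> V \<times> UNIV \<Longrightarrow>
      \<exists>u i. (u, i) \<in> W \<and>
        ((\<exists>v. (v, i) \<notin> W \<and> h i u v \<noteq> 0) \<or> (u, \<not> i) \<notin> W \<and> r u \<noteq> 0)"
begin

lemma sum_h_neighbours:
  assumes "finite B" "N = {v. (u, v) \<in> E}"
  shows "(\<Sum>v\<in>B. h i u v) = (\<Sum>v\<in>B \<inter> N. h i u v)"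
  using assms h_E by (intro sum.mono_neutral_right) auto

lemma degree_neighbours:
  assumes "{v. (u, v) \<in> E} = N" "u \<in> V"
  shows "(\<Sum>v\<in>N. h i u v) + r u = 2"
proof -
  have "V \<inter> N = N"
    using assms E_V by auto
  then show ?thesis
    using degree[OF assms(2), of i] sum_h_neighbours[OF finite_V assms(1)[symmetric], of i] by simp
qed

lemma leaves_columns:
  assumes "X \<subseteq> V" "X \<noteq> {}" "X \<noteq> V"
  shows "\<exists>u\<in>X. \<exists>v i. v \<notin> X \<and> (u, v) \<in> E \<and> h i u v \<noteq> 0"
proof -
  have "X \<times> (UNIV :: bool set) \<noteq> V \<times> UNIV" "X \<times> (UNIV :: bool set) \<noteq> {}"
    using assms by auto
  with leaves[of "X \<times> UNIV"] assms(1) show ?thesis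
    using h_E by fastforce
qed

end

text \<open>Indexing the vertices of a cycle by all natural numbers, modulo its length, avoids any case
distinction at the point where the cycle closes.\<close>

lemma cycle_enumeration:
  assumes "pre_digraph.cycle (with_proj G) p"
  obtains vtx where "\<forall>k l. vtx k = vtx l \<longleftrightarrow> k mod length p = l mod length p"
    and "set p = {(vtx k, vtx (Suc k)) | k. True}" and "range vtx = fst ` set p"
proof -
  interpret pair_pre_digraph G .
  obtain u where u: "awalk u p u" "distinct (tl (pawalk_verts u p))" "p \<noteq> []"
    using assms unfolding cycle_def by auto
  then have cas: "pcas u p u"
    by (simp add: awalk_def)
  let ?n = "length p"
  define vtx where "vtx k = fst (p ! (k mod ?n))" for k
  have n: "?n > 0" using u by simp
  obtain m where m: "?n = Suc m"
    using n by (cases ?n) auto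
  have wrap: "Suc (j + m) mod ?n = j mod ?n" for j
    by (metis m add_Suc_right mod_add_self2)
  have walk: "(\<forall>k. Suc k < length q \<longrightarrow> snd (q ! k) = fst (q ! Suc k)) \<and>
      (q \<noteq> [] \<longrightarrow> fst (q ! 0) = x \<and> snd (q ! (length q - 1)) = y) \<and>
      pawalk_verts x q = x # map snd q"
    if "pcas x q y" for q x y
    using that
  proof (induction q arbitrary: x)
    case (Cons e q)
    then have IH: "(\<forall>k. Suc k < length q \<longrightarrow> snd (q ! k) = fst (q ! Suc k)) \<and>
      (q \<noteq> [] \<longrightarrow> fst (q ! 0) = snd e \<and> snd (q ! (length q - 1)) = y) \<and>
      pawalk_verts (snd e) q = snd e # map snd q" and "fst e = x"
      by auto
    moreover have "snd e = y" if "q = []"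
      using Cons.prems that by simp
    ultimately show ?case
      by (auto simp: nth_Cons split: nat.splits)
  qed simp
  have step: "snd (p ! (k mod ?n)) = vtx (Suc k)" for k
  proof (cases "Suc (k mod ?n) = ?n")
    case True
    then have "Suc k mod ?n = 0" "k mod ?n = ?n - 1"
      by (simp_all add: mod_Suc)
    then show ?thesis
      using walk[OF cas] u(3) by (simp add: vtx_def)
  next
    case False
    then have "Suc (k mod ?n) < ?n"
      using n by (simp add: Suc_lessI)
    then show ?thesis
      using walk[OF cas] False by (simp add: vtx_def mod_Suc)
  qed
  have p_nth: "p ! (k mod ?n) = (vtx k, vtx (Suc k))" for k
    using step[of k] by (simp add: vtx_def prod_eq_iff)
  have set_p: "set p = {(vtx k, vtx (Suc k)) | k. True}"
  proof -
    have "set p = {p ! (k mod ?n) | k. True}"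
    proof (intro equalityI subsetI)
      fix e assume "e \<in> set p"
      then obtain k where "k < ?n" "e = p ! k" by (auto simp: in_set_conv_nth)
      then show "e \<in> {p ! (k mod ?n) | k. True}" by (auto intro!: exI[of _ k])
    next
      fix e assume "e \<in> {p ! (k mod ?n) | k. True}"
      then show "e \<in> set p" using n by auto
    qed
    then show ?thesis by (simp add: p_nth)
  qed
  have "distinct (map snd p)"
    using u(2) walk[OF cas] by simp
  then have inj: "k mod ?n = l mod ?n" if "vtx (Suc k) = vtx (Suc l)" for k l
    using that step[of k] step[of l] n nth_eq_iff_index_eq[of "map snd p" "k mod ?n" "l mod ?n"]
    by simp
  have "vtx k = vtx l \<longleftrightarrow> k mod ?n = l mod ?n" for k l
  proof
    assume "vtx k = vtx l"
    then have "vtx (Suc (k + m)) = vtx (Suc (l + m))"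
      by (simp add: vtx_def wrap)
    then have "(k + m) mod ?n = (l + m) mod ?n"
      by (rule inj)
    then have "Suc (k + m) mod ?n = Suc (l + m) mod ?n"
      by (metis mod_Suc_eq)
    then show "k mod ?n = l mod ?n"
      by (simp only: wrap)
  qed (simp add: vtx_def)
  moreover have "range vtx = fst ` set p"
    unfolding set_p by force
  ultimately show thesis
    using that set_p by blast
qed

lemma prism_arc_iff:
  "((u, i), (v, j)) \<in> parcs (prism G) \<longleftrightarrow>
    (u, v) \<in> parcs G \<and> i = j \<or> u = v \<and> u \<in> pverts G \<and> i \<noteq> j"
  by (cases i; cases j) (auto simp: prism_def cartesian_product_def K2_def)

text \<open>The edges of the cycle are taken in both directions; the two neighbours of a vertex on the cycle
are distinct because the cycle has length at least three.\<close>

lemma hamilton_cycle_two_factor: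
  assumes "pair_graph G" and ham: "hamilton_cycle (prism G) p"
  shows "\<exists>h r. prism_two_factor (pverts G) (parcs G) h r"
proof -
  interpret pair_graph G by fact
  let ?V = "pverts G" and ?E = "parcs G" and ?n = "length p"
  have cyc: "pre_digraph.cycle (with_proj (prism G)) p" and n: "?n \<ge> 3"
    and span: "fst ` set p = ?V \<times> UNIV"
    using ham by (auto simp: hamilton_cycle_def prism_def cartesian_product_def K2_def)
  obtain vtx where vtx_all: "\<forall>k l. vtx k = vtx l \<longleftrightarrow> k mod ?n = l mod ?n"
    and set_p: "set p = {(vtx k, vtx (Suc k)) | k. True}" and rng: "range vtx = fst ` set p"
    by (rule cycle_enumeration[OF cyc]) (rule that; assumption)
  have range: "range vtx = ?V \<times> UNIV"
    using rng span by (rule trans)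
  note vtx = vtx_all[rule_format]
  have sub: "set p \<subseteq> parcs (prism G)"
    using cyc by (auto simp: pre_digraph.cycle_def pre_digraph.awalk_def)
  obtain m where m: "?n = Suc m"
    using n by (cases ?n) auto
  have wrap: "Suc (j + m) mod ?n = j mod ?n" for j
    by (metis m add_Suc_right mod_add_self2)
  define F where "F = set p \<union> (set p)\<inverse>"
  have F_iff: "(vtx k, w) \<in> F \<longleftrightarrow> w = vtx (Suc k) \<or> w = vtx (k + m)" for k w
  proof -
    have "(vtx k, w) \<in> set p \<longleftrightarrow> w = vtx (Suc k)"
      unfolding set_p by (auto simp: vtx) (metis mod_Suc_eq)
    moreover have "(w, vtx k) \<in> set p \<longleftrightarrow> w = vtx (k + m)"
    proof
      assume "(w, vtx k) \<in> set p"
      then obtain l where l: "w = vtx l" "k mod ?n = Suc l mod ?n"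
        unfolding set_p by (auto simp: vtx)
      then have "(k + m) mod ?n = (Suc l + m) mod ?n"
        by (metis mod_add_left_eq)
      also have "\<dots> = l mod ?n"
        by (simp only: add_Suc wrap)
      finally show "w = vtx (k + m)"
        using l by (simp add: vtx)
    next
      assume "w = vtx (k + m)"
      moreover have "vtx (Suc (k + m)) = vtx k"
        unfolding vtx by (rule wrap)
      ultimately show "(w, vtx k) \<in> set p"
        unfolding set_p by force
    qed
    ultimately show ?thesis
      unfolding F_def by blast
  qed
  have card_F: "card {w. (x, w) \<in> F} = 2" if "x \<in> ?V \<times> UNIV" for x
  proof -
    have "x \<in> range vtx"
      using that by (simp only: range)
    then obtain k where k: "x = vtx k"
      by (rule rangeE)
    have "vtx (Suc k) \<noteq> vtx (k + m)"
    proof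
      assume "vtx (Suc k) = vtx (k + m)"
      then have "Suc (Suc k mod ?n) mod ?n = Suc ((k + m) mod ?n) mod ?n"
        by (simp only: vtx)
      then have "Suc (Suc k) mod ?n = k mod ?n"
        by (simp only: mod_Suc_eq wrap)
      then have "?n dvd Suc (Suc k) - k"
        by (subst mod_eq_dvd_iff_nat[symmetric]) simp_all
      then have "?n \<le> 2"
        by (intro dvd_imp_le) auto
      then show False
        using n by simp
    qed
    then show ?thesis
      by (simp add: k F_iff Collect_disj_eq)
  qed
  have sym_F: "(x, y) \<in> F \<longleftrightarrow> (y, x) \<in> F" for x y
    by (auto simp: F_def)
  have F_arc: "(u, v) \<in> ?E \<and> i = j \<or> u = v \<and> u \<in> ?V \<and> i \<noteq> j"
    if "((u, i), (v, j)) \<in> F" for u v i j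
  proof -
    have "((u, i), (v, j)) \<in> parcs (prism G) \<or> ((v, j), (u, i)) \<in> parcs (prism G)"
      using that subsetD[OF sub] unfolding F_def by blast
    then show ?thesis
      unfolding prism_arc_iff using arcs_symmetric by metis
  qed
  define h where "h i u v = (of_bool (((u, i), (v, i)) \<in> F) :: nat)" for i u v
  define r where "r u = (of_bool (((u, False), (u, True)) \<in> F) :: nat)" for u
  have r_iff: "r u \<noteq> 0 \<longleftrightarrow> ((u, i), (u, \<not> i)) \<in> F" for u i
    by (cases i) (auto simp: r_def sym_F)
  have no_loop: "(u, u) \<notin> ?E" for u
    using no_loops by force
  have "prism_two_factor ?V ?E h r"
  proof
    show "finite ?V" by simp
    show "u \<in> ?V \<and> v \<in> ?V" if "(u, v) \<in> ?E" for u v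
      using that wellformed' by blast
    show "h i u v \<le> 1" for i u v by (simp add: h_def)
    show "r u \<le> 1" for u by (simp add: r_def)
    show "h i u v = h i v u" for i u v by (simp add: h_def sym_F[of "(u, i)"])
    show "(u, v) \<in> ?E" if "h i u v \<noteq> 0" for i u v
      using that F_arc[of u i v i] by (auto simp: h_def)
    show "(\<Sum>v\<in>?V. h i u v) + r u = 2" if "u \<in> ?V" for i u
    proof -
      let ?A = "{v \<in> ?V. ((u, i), (v, i)) \<in> F}" and ?B = "{w. w = (u, \<not> i) \<and> r u \<noteq> 0}"
      have "{w. ((u, i), w) \<in> F} = (\<lambda>v. (v, i)) ` ?A \<union> ?B"
      proof (intro set_eqI)
        fix w :: "'a \<times> bool"
        obtain v j where w: "w = (v, j)" by (cases w)
        show "w \<in> {w. ((u, i), w) \<in> F} \<longleftrightarrow> w \<in> (\<lambda>v. (v, i)) ` ?A \<union> ?B"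
        proof (cases "j = i")
          case True
          then show ?thesis
            using F_arc[of u i v i] in_arcsD2[of u v] by (auto simp: w)
        next
          case False
          then have "j = (\<not> i)" by simp
          then show ?thesis
            using F_arc[of u i v j] r_iff[of u i] by (auto simp: w)
        qed
      qed
      moreover have "card ((\<lambda>v. (v, i)) ` ?A \<union> ?B) = card ?A + card ?B"
        by (subst card_Un_disjoint) (auto simp: card_image inj_on_def)
      moreover have "card ?B = r u"
        by (auto simp: r_def)
      moreover have "card ?A = (\<Sum>v\<in>?V. h i u v)"
        by (simp add: h_def of_bool_def sum.If_cases Int_def)
      ultimately show ?thesis
        using card_F[of "(u, i)"] that by simp
    qed
    show "\<exists>u i. (u, i) \<in> W \<and> ((\<exists>v. (v, i) \<notin> W \<and> h i u v \<noteq> 0) \<or> (u, \<not> i) \<notin> W \<and> r u \<noteq> 0)"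
      if W: "W \<subseteq> ?V \<times> UNIV" "W \<noteq> {}" "W \<noteq> ?V \<times> UNIV" for W
    proof (rule ccontr)
      assume none: "\<not> ?thesis"
      have closed: "y \<in> W" if "x \<in> W" "(x, y) \<in> F" for x y
      proof (rule ccontr)
        assume "y \<notin> W"
        note xW = that(1) and xF = that(2)
        obtain u i v j where xy: "x = (u, i)" "y = (v, j)"
          by (cases x; cases y)
        consider "i = j" | "u = v" "j = (\<not> i)"
          using F_arc[of u i v j] xF unfolding xy by auto
        then show False
        proof cases
          case 1
          then have "h i u v \<noteq> 0"
            using xF by (simp add: h_def xy)
          then show False
            using none xW \<open>y \<notin> W\<close> 1 unfolding xy by blast
        next
          case 2
          then have "r u \<noteq> 0"
            using xF r_iff[of u i] by (simp add: xy)
          then show False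
            using none xW \<open>y \<notin> W\<close> 2 unfolding xy by blast
        qed
      qed
      obtain x where "x \<in> W" "x \<in> range vtx"
        unfolding range using W(1,2) by blast
      then obtain k where k: "vtx k \<in> W"
        by blast
      have "vtx (k + l) \<in> W" for l
        by (induction l) (use k closed F_iff in auto)
      moreover have "\<exists>l'. vtx l = vtx (k + l')" for l
      proof -
        have "k + (l + m * k) = l + ?n * k"
          by (simp add: m)
        then have "vtx (k + (l + m * k)) = vtx l"
          by (simp only: vtx mod_mult_self2)
        then show ?thesis by metis
      qed
      ultimately have "range vtx \<subseteq> W" by (metis image_subsetI)
      then show False
        using W range by simp
    qed
  qed
  then show ?thesis by blast
qed

section \<open>Counting crossings of spiders and cells\<close>

text \<open>The right-hand sides are the complete neighbourhoods, so that \<open>x\<close>, \<open>y\<close>, \<open>z\<close> are the only vertices outside the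
spider that it is joined to.\<close>

definition spider_at :: "('a \<times> 'a) set \<Rightarrow> 'a list \<Rightarrow> 'a \<Rightarrow> 'a \<Rightarrow> 'a \<Rightarrow> bool" where
  "spider_at E ns x y z \<longleftrightarrow> (\<exists>s a b c d. ns = [s, a, b, c, d] \<and> distinct [s, a, b, c, d, x, y, z] \<and>
     {v. (s, v) \<in> E} = {a, b, c} \<and> {v. (a, v) \<in> E} = {s, x, y} \<and> {v. (b, v) \<in> E} = {s, y, z} \<and>
     {v. (c, v) \<in> E} = {s, d, z} \<and> {v. (d, v) \<in> E} = {c, x, z})"

context prism_two_factor
begin

definition H :: "'a \<Rightarrow> 'a \<Rightarrow> nat" where
  "H u v = h False u v + h True u v"

text \<open>The number of crossings is even and positive, hence at least two. Suppose that it is two and that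
both crossings end in copies of \<open>x\<close>. Then the leg \<open>b\<close> can only be reached from \<open>s\<close>, so it uses up one edge
at each copy of \<open>s\<close>. The rung at \<open>s\<close> would cut off \<open>s\<close> and \<open>b\<close>, so each copy of \<open>s\<close> has one further edge to
\<open>a\<close> or to \<open>c\<close>. If both go to the same leg, then one of these two legs is cut off from the rest of the
spider, and one of the two parts is never left. Otherwise, say, copy \<open>j\<close> of \<open>s\<close> is
joined to \<open>c\<close> and the other copy to \<open>a\<close>; then the copies of \<open>a\<close> and of \<open>d\<close> in layer \<open>j\<close> are both joined to
the copy of \<open>x\<close> in that layer, which closes the cycle prematurely again.\<close>

lemma spider_crossings:
  assumes "spider_at E [s, a, b, c, d] x y z"
  shows "H a x + H d x + H a y + H b y + H b z + H c z + H d z \<ge> 2"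
    and "H a x + H d x \<ge> 2 \<Longrightarrow> H a x + H d x + H a y + H b y + H b z + H c z + H d z \<ge> 4"
proof -
  have dist: "distinct [s, a, b, c, d, x, y, z]"
    and nb: "{v. (s, v) \<in> E} = {a, b, c}" "{v. (a, v) \<in> E} = {s, x, y}"
     "{v. (b, v) \<in> E} = {s, y, z}" "{v. (c, v) \<in> E} = {s, d, z}" "{v. (d, v) \<in> E} = {c, x, z}"
    using assms by (auto simp: spider_at_def)
  have E: "(s, v) \<in> E \<longleftrightarrow> v \<in> {a, b, c}" "(a, v) \<in> E \<longleftrightarrow> v \<in> {s, x, y}"
     "(b, v) \<in> E \<longleftrightarrow> v \<in> {s, y, z}" "(c, v) \<in> E \<longleftrightarrow> v \<in> {s, d, z}"
     "(d, v) \<in> E \<longleftrightarrow> v \<in> {c, x, z}" for v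
    using nb by blast+
  have V: "{s, a, b, c, d, x, y, z} \<subseteq> V"
    using E_V[of s a] E_V[of s b] E_V[of c d] E_V[of a x] E_V[of a y] E_V[of c z] E[of a] E[of b]
      E[of d] E[of x] E[of y] E[of z] by (simp add: E_V)
  have deg: "h i s a + h i s b + h i s c + r s = 2"
    "h i s a + h i a x + h i a y + r a = 2"
    "h i s b + h i b y + h i b z + r b = 2"
    "h i s c + h i c d + h i c z + r c = 2"
    "h i c d + h i d x + h i d z + r d = 2" for i
    using degree_neighbours[OF nb(1), of i] degree_neighbours[OF nb(2), of i]
      degree_neighbours[OF nb(3), of i] degree_neighbours[OF nb(4), of i]
      degree_neighbours[OF nb(5), of i] V dist
      h_sym[of i a s] h_sym[of i b s] h_sym[of i c s] h_sym[of i d c]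
    by (simp_all add: add.assoc)
  let ?total = "H a x + H d x + H a y + H b y + H b z + H c z + H d z"
  have cut: "\<exists>u\<in>X. \<exists>v i. v \<notin> X \<and> (u, v) \<in> E \<and> h i u v \<noteq> 0"
    if "X \<subseteq> {s, a, b, c, d}" "X \<noteq> {}" for X
    using leaves_columns[of X] that V dist by auto
  have tot: "?total \<noteq> 0"
  proof
    assume "?total = 0"
    then have "h i a x = 0 \<and> h i d x = 0 \<and> h i a y = 0 \<and> h i b y = 0 \<and> h i b z = 0 \<and>
      h i c z = 0 \<and> h i d z = 0" for i
      by (cases i) (simp_all add: H_def)
    with cut[of "{s, a, b, c, d}"] dist show False
      by (auto simp: E)
  qed
  have even: "even ?total"
  proof -
    define att where "att i = h i a x + h i d x + h i a y + h i b y + h i b z + h i c z + h i d z" for i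
    let ?R = "r s + r a + r b + r c + r d"
    have "att i + ?R + 2 * (h i s a + h i s b + h i s c + h i c d) = 10" for i
    proof -
      have "att i + ?R + 2 * (h i s a + h i s b + h i s c + h i c d) =
        (h i s a + h i s b + h i s c + r s) + (h i s a + h i a x + h i a y + r a) +
        (h i s b + h i b y + h i b z + r b) + (h i s c + h i c d + h i c z + r c) +
        (h i c d + h i d x + h i d z + r d)"
        by (simp add: att_def)
      also have "\<dots> = 10"
        by (simp only: deg)
      finally show ?thesis .
    qed
    then have "even (att i + ?R)" for i
      by (metis dvd_add_left_iff dvd_triv_left even_numeral)
    then have "even (att True + att False)"
      by (meson even_add)
    moreover have "?total = att True + att False"
      by (simp add: H_def att_def)
    ultimately show ?thesis by simp
  qed
  with tot show "?total \<ge> 2"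
    by (metis One_nat_def less_2_cases not_le odd_one)
  show "?total \<ge> 4" if tx: "H a x + H d x \<ge> 2"
  proof (rule ccontr)
    assume "\<not> ?thesis"
    then have "?total \<noteq> 3 \<Longrightarrow> H a x + H d x = 2 \<and> H a y + H b y + H b z + H c z + H d z = 0"
      using tx by linarith
    moreover have "?total \<noteq> 3"
      using even by force
    ultimately have two: "H a x + H d x = 2" and "H a y + H b y + H b z + H c z + H d z = 0"
      by simp_all
    then have z: "h i a y = 0" "h i b y = 0" "h i b z = 0" "h i c z = 0" "h i d z = 0" for i
      by (cases i; simp add: H_def)+
    \<comment> \<open>the leg \<open>b\<close> is reached from \<open>s\<close> only\<close>
    have sb: "h i s b = 1" "r b = 1" for i
      using deg(3)[of i] z(2,3)[of i] h_le[of i s b] r_le[of b] by linarith+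
    obtain j where "h j s a \<noteq> 0 \<or> h j s c \<noteq> 0"
      using cut[of "{s, b}"] dist by (auto simp: E z)
    then have rs: "r s = 0"
      using deg(1)[of j] sb(1)[of j] by auto
    have sac: "h i s a + h i s c = 1" for i
      using deg(1)[of i] sb rs by simp
    have cut_cd: "\<exists>i. h i s c \<noteq> 0 \<or> h i d x \<noteq> 0"
      using cut[of "{c, d}"] dist by (auto simp: E z h_sym[of _ c s])
    have cut_sbcd: "\<exists>i. h i s a \<noteq> 0 \<or> h i d x \<noteq> 0"
      using cut[of "{s, b, c, d}"] dist by (auto simp: E z)
    have two': "h j a x + h (\<not> j) a x + h j d x + h (\<not> j) d x = 2" for j
      using two by (cases j) (simp_all add: H_def)
    \<comment> \<open>the two copies of \<open>s\<close> lead to different legs\<close>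
    have one_each: False if sa: "h (\<not> j) s a = 1" "h j s a = 0" for j
    proof -
      have "h j a x = 1"
        using deg(2)[of j] sa z(1)[of j] h_le[of j a x] r_le[of a] by linarith
      moreover have "h j s c = 1" "h (\<not> j) s c = 0"
        using sac[of j] sac[of "\<not> j"] sa by simp_all
      then have "r c = 1" "h j c d = 0"
        using deg(4)[of j] deg(4)[of "\<not> j"] z(4) r_le[of c] h_le[of "\<not> j" c d] by auto
      then have "h j d x = 1"
        using deg(5)[of j] z(5)[of j] h_le[of j d x] r_le[of d] by linarith
      ultimately have x: "h j a x = 1" "h j d x = 1" "h (\<not> j) a x = 0" "h (\<not> j) d x = 0"
        using two'[of j] by simp_all
      \<comment> \<open>the spider together with one copy of \<open>x\<close> is never left\<close>
      let ?W = "{s, a, b, c, d} \<times> UNIV \<union> {(x, j)}"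
      have "(x, \<not> j) \<notin> ?W"
        using dist by auto
      then have neq: "?W \<noteq> V \<times> UNIV"
        using V by blast
      have "?W \<subseteq> V \<times> UNIV" "?W \<noteq> {}"
        using V by auto
      from leaves[OF this neq] obtain u i where ui: "(u, i) \<in> ?W \<and>
        ((\<exists>v. (v, i) \<notin> ?W \<and> h i u v \<noteq> 0) \<or> (u, \<not> i) \<notin> ?W \<and> r u \<noteq> 0)"
        by (elim exE) (rule that)
      note u = conjunct1[OF ui] conjunct2[OF ui]
      have deg_x: "(\<Sum>v\<in>V. h j x v) + r x = 2"
        using V by (simp add: degree)
      have sub: "(\<Sum>v\<in>X. h j x v) \<le> (\<Sum>v\<in>V. h j x v)" if "X \<subseteq> V" for X
        using that finite_V by (intro sum_mono2) auto
      show False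
      proof (cases "u = x")
        case False
        with u(1) have "u \<in> {s, a, b, c, d}" by auto
        with u(2) obtain v where v: "(v, i) \<notin> ?W" "h i u v \<noteq> 0" by auto
        then have "(u, v) \<in> E" by (simp add: h_E)
        with v \<open>u \<in> _\<close> x show False
          by (cases "i = j") (auto simp: E z)
      next
        case True
        then have [simp]: "i = j"
          using u(1) dist by auto
        from u(2) True show False
        proof (elim disjE exE conjE)
          fix v assume v: "(v, i) \<notin> ?W" "h i u v \<noteq> 0"
          then have "v \<in> V" using h_E E_V by blast
          then have "{a, d, v} \<subseteq> V" using V by simp
          from sub[OF this] deg_x v dist x h_sym[of j x a] h_sym[of j x d] True show False
            by auto
        next
          assume "r u \<noteq> 0"
          moreover have "{a, d} \<subseteq> V" using V by simp
          from sub[OF this] deg_x dist x h_sym[of j x a] h_sym[of j x d] True have "r x = 0"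
            by auto
          ultimately show False using True by simp
        qed
      qed
    qed
    have le: "h i s a = 0 \<or> h i s a = 1" for i
      using h_le[of i s a] by linarith
    have "\<not> (h (\<not> j) s a = 1 \<and> h j s a = 0)" for j
      using one_each by blast
    from this[of True] this[of False] le[of True] le[of False]
    consider "\<forall>i. h i s a = 1" | "\<forall>i. h i s a = 0"
      by (auto simp: all_bool_eq)
    then show False
    proof cases
      case 1
      then have sc: "h i s c = 0" for i
        using sac[of i] by simp
      from 1 have ax: "h i a x + r a = 1" for i
        using deg(2)[of i] z(1) by simp
      obtain j where "h j a x \<noteq> 0"
        using cut[of "{s, a, b}"] dist by (auto simp: E z sc)
      then have "r a = 0"
        using ax[of j] by auto
      then have "h i a x = 1" for i
        using ax[of i] by simp
      then have "h i d x = 0" for i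
        using two'[of i] by simp
      with sc cut_cd show False by simp
    next
      case 2
      then have "h i a x = 1" for i
        using deg(2)[of i] z(1)[of i] h_le[of i a x] r_le[of a] by simp
      then have "h i d x = 0" for i
        using two'[of i] by simp
      with 2 cut_sbcd show False by simp
    qed
  qed
qed

text \<open>Write \<open>x\<^sub>i\<close> for the number of crossings from the \<open>i\<close>th spider to \<open>t\<close> and \<open>y\<^sub>i\<close> for those to the corners. If some
\<open>x\<^sub>i\<close> is at least two, then \<open>x\<^sub>i + y\<^sub>i \<ge> 4\<close>, so the \<open>y\<^sub>i\<close> sum to at least \<open>8 - 4\<close>, because the \<open>x\<^sub>i\<close> sum to
at most four. Otherwise they sum to at most three, and the degree equation of \<open>t\<close> yields the claim.\<close>

lemma cell_crossings:
  assumes "spider_at E [s1, a1, b1, c1, d1] t p q"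
    and "spider_at E [s2, a2, b2, c2, d2] t q r'"
    and "spider_at E [s3, a3, b3, c3, d3] t r' p"
    and nb: "{v. (t, v) \<in> E} = {a1, d1, a2, d2, a3, d3, p, q, r'}"
    and dist: "distinct [a1, d1, a2, d2, a3, d3, p, q, r']"
  shows "4 \<le> H t p + H t q + H t r'
    + (H a1 p + H b1 p + H b1 q + H c1 q + H d1 q)
    + (H a2 q + H b2 q + H b2 r' + H c2 r' + H d2 r')
    + (H a3 r' + H b3 r' + H b3 p + H c3 p + H d3 p)"
proof -
  have "t \<in> V"
    using nb E_V by blast
  have sym: "H u v = H v u" for u v
    by (simp add: H_def h_sym[of _ u v])
  have "h i t a1 + h i t d1 + h i t a2 + h i t d2 + h i t a3 + h i t d3
    + h i t p + h i t q + h i t r' + r t = 2" for i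
    using degree_neighbours[OF nb \<open>t \<in> V\<close>, of i] dist by (simp add: add.assoc)
  from arg_cong2[OF this[of False] this[of True], of "(+)"]
  have t: "(H a1 t + H d1 t) + (H a2 t + H d2 t) + (H a3 t + H d3 t)
    + (H t p + H t q + H t r') + 2 * r t = 4"
    unfolding sym[of _ t] by (simp add: H_def)
  have count: "4 \<le> w + y1 + y2 + y3"
    if "2 \<le> x1 + y1" "2 \<le> x1 \<longrightarrow> 4 \<le> x1 + y1" "2 \<le> x2 + y2" "2 \<le> x2 \<longrightarrow> 4 \<le> x2 + y2"
      "2 \<le> x3 + y3" "2 \<le> x3 \<longrightarrow> 4 \<le> x3 + y3" "x1 + x2 + x3 + w + 2 * z = 4" "z \<le> 1"
    for w x1 x2 x3 y1 y2 y3 z :: nat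
  proof -
    consider "2 \<le> x1 \<or> 2 \<le> x2 \<or> 2 \<le> x3" | "x1 \<le> 1" "x2 \<le> 1" "x3 \<le> 1"
      by linarith
    then show ?thesis
    proof cases
      case 1
      then show ?thesis using that by (elim disjE) simp_all
    next
      case 2
      then show ?thesis using that by (cases "z = 0") simp_all
    qed
  qed
  show ?thesis
    using spider_crossings[OF assms(1)] spider_crossings[OF assms(2)] spider_crossings[OF assms(3)]
    by (intro count[OF _ _ _ _ _ _ t r_le]) (simp_all add: add.assoc)
qed

end

section \<open>The graph\<close>

text \<open>The frame has the vertices \<open>0\<close>, ..., \<open>5\<close>: two adjacent poles \<open>0\<close> and \<open>1\<close>, both joined to all vertices of the
path \<open>2 - 3 - 4 - 5\<close>. Its bounded faces are listed here; the outer face is \<open>0 1 5\<close>.\<close>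

definition corner :: "nat \<Rightarrow> nat \<Rightarrow> nat" where
  "corner k c = [[0, 1, 2], [0, 2, 3], [0, 3, 4], [0, 4, 5], [1, 2, 3], [1, 3, 4], [1, 4, 5]] ! k ! c"

text \<open>Local names for the vertices of a cell: \<open>0\<close> is the centre, \<open>1\<close> to \<open>15\<close> are the spiders, and \<open>16\<close>, \<open>17\<close>, \<open>18\<close> stand for
the corners, which are shared between cells.\<close>

definition node :: "nat \<Rightarrow> nat \<Rightarrow> nat" where
  "node k j = (if j < 16 then 6 + 16 * k + j else corner k (j - 16))"

definition spider_edges :: "nat \<Rightarrow> nat \<Rightarrow> nat \<Rightarrow> nat \<Rightarrow> (nat \<times> nat) list" where
  "spider_edges s x y z =
    [(s, s + 1), (s, s + 2), (s, s + 3), (s + 3, s + 4), (s + 1, x), (s + 1, y),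
     (s + 2, y), (s + 2, z), (s + 3, z), (s + 4, x), (s + 4, z)]"

definition cell_edges :: "(nat \<times> nat) list" where
  "cell_edges = [(0, 16), (0, 17), (0, 18)] @ spider_edges 1 0 16 17 @ spider_edges 6 0 17 18
    @ spider_edges 11 0 18 16"

definition frame_edges :: "(nat \<times> nat) list" where
  "frame_edges = [(0, 1), (0, 2), (0, 3), (0, 4), (0, 5), (1, 2), (1, 3), (1, 4), (1, 5),
    (2, 3), (3, 4), (4, 5)]"

definition edges :: "(nat \<times> nat) set" where
  "edges = set frame_edges \<union> {(node k i, node k j) | k i j. k < 7 \<and> (i, j) \<in> set cell_edges}"

definition spider_graph :: "nat pair_pre_digraph" where
  "spider_graph = \<lparr> pverts = {..<118}, parcs = edges \<union> edges\<inverse> \<rparr>"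

definition cell_adj :: "nat \<Rightarrow> nat list" where
  "cell_adj j = map snd (filter (\<lambda>e. fst e = j) (cell_edges @ map prod.swap cell_edges))"

lemma cell_adj_eqs:
  "cell_adj 0 = [16, 17, 18, 2, 5, 7, 10, 12, 15]"
  "cell_adj 1 = [2, 3, 4]" "cell_adj 2 = [0, 16, 1]" "cell_adj 3 = [16, 17, 1]"
  "cell_adj 4 = [5, 17, 1]" "cell_adj 5 = [0, 17, 4]"
  "cell_adj 6 = [7, 8, 9]" "cell_adj 7 = [0, 17, 6]" "cell_adj 8 = [17, 18, 6]"
  "cell_adj 9 = [10, 18, 6]" "cell_adj 10 = [0, 18, 9]"
  "cell_adj 11 = [12, 13, 14]" "cell_adj 12 = [0, 18, 11]" "cell_adj 13 = [18, 16, 11]"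
  "cell_adj 14 = [15, 16, 11]" "cell_adj 15 = [0, 16, 14]"
  by code_simp+

lemma set_cell_adj: "i \<in> set (cell_adj j) \<longleftrightarrow> (j, i) \<in> set cell_edges \<or> (i, j) \<in> set cell_edges"
  by (force simp: cell_adj_def)

lemma cell_edges_less: "(i, j) \<in> set cell_edges \<Longrightarrow> i < 16 \<and> j < 19 \<and> i \<noteq> j"
proof -
  have "\<forall>(i, j) \<in> set cell_edges. i < 16 \<and> j < 19 \<and> i \<noteq> j" by code_simp
  then show "(i, j) \<in> set cell_edges \<Longrightarrow> i < 16 \<and> j < 19 \<and> i \<noteq> j" by blast
qed

lemma frame_edges_less: "(i, j) \<in> set frame_edges \<Longrightarrow> i < 6 \<and> j < 6 \<and> i \<noteq> j"
  by (auto simp: frame_edges_def)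

lemma frame_vertex_edge:
  assumes "b < 6"
  obtains u v where "(u, v) \<in> set frame_edges" "b = u \<or> b = v"
proof -
  have "\<forall>b \<in> set [0..<6]. \<exists>e \<in> set frame_edges. fst e = b \<or> snd e = b"
    by code_simp
  then show thesis
    using assms that by fastforce
qed

lemma corner_facts:
  assumes "k < 7"
  shows "corner k 0 < 6" "corner k 1 < 6" "corner k 2 < 6"
    "distinct [corner k 0, corner k 1, corner k 2]"
proof -
  have "\<forall>k \<in> set [0..<7]. corner k 0 < 6 \<and> corner k 1 < 6 \<and> corner k 2 < 6 \<and>
    distinct [corner k 0, corner k 1, corner k 2]"
    by code_simp
  then show "corner k 0 < 6" "corner k 1 < 6" "corner k 2 < 6"
    "distinct [corner k 0, corner k 1, corner k 2]"
    using assms by auto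
qed

lemma node_simps [simp]:
  "j < 16 \<Longrightarrow> node k j = 6 + 16 * k + j"
  "node k 16 = corner k 0" "node k 17 = corner k 1" "node k 18 = corner k 2"
  by (simp_all add: node_def)

lemma node_corner_cases:
  assumes "j < (19 :: nat)"
  obtains "j < 16" | "j = 16" | "j = 17" | "j = 18"
  using assms by linarith

lemma node_less_6_iff:
  assumes "k < 7" "j < 19"
  shows "node k j < 6 \<longleftrightarrow> 16 \<le> j"
  using assms(2) corner_facts[OF assms(1)] by (cases rule: node_corner_cases) auto

lemma node_less:
  assumes "k < 7" "j < 19"
  shows "node k j < 118"
  using assms(2) corner_facts[OF assms(1)] assms(1) by (cases rule: node_corner_cases) auto

lemma node_eq_node_inner:
  assumes "k < 7" "j < 16" "k' < 7" "i < 19" "node k' i = node k j"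
  shows "k' = k \<and> i = j"
proof -
  have "i < 16"
    using node_less_6_iff[OF assms(3,4)] assms(2,5) by simp
  then have eq: "j + k * 16 = i + k' * 16"
    using assms by simp
  from arg_cong[OF eq, of "\<lambda>n. n div 16"] arg_cong[OF eq, of "\<lambda>n. n mod 16"]
  show ?thesis
    using \<open>j < 16\<close> \<open>i < 16\<close> by simp
qed

lemma inj_on_node: "k < 7 \<Longrightarrow> inj_on (node k) {..<19}"
proof (rule inj_onI)
  fix i j assume k: "k < 7" and ij: "i \<in> {..<19}" "j \<in> {..<19}" and eq: "node k i = node k j"
  show "i = j"
  proof (cases "i < 16 \<or> j < 16")
    case True
    then show ?thesis
      using node_eq_node_inner[OF k _ k, of i j] node_eq_node_inner[OF k _ k, of j i] ij eq
      by auto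
  next
    case False
    then have "i \<in> {16, 17, 18}" "j \<in> {16, 17, 18}" using ij by auto
    then show ?thesis
      using corner_facts(4)[OF k] eq by auto
  qed
qed

lemma lessThan_16:
  "{..<16 :: nat} = {0, 1, 2, 3, 4, 5, 6, 7, 8, 9, 10, 11, 12, 13, 14, 15}"
proof -
  have "[0..<16] = [0, 1, 2, 3, 4, 5, 6, 7, 8, 9, 10, 11, 12, 13, 14, 15]"
    by code_simp
  then show ?thesis
    by (metis atLeast_upt list.set)
qed

lemma distinct_map_node:
  "k < 7 \<Longrightarrow> distinct xs \<Longrightarrow> set xs \<subseteq> {..<19} \<Longrightarrow> distinct (map (node k) xs)"
  unfolding distinct_map using inj_on_node inj_on_subset by blast

lemma vertex_cases:
  assumes "v < 118"
  obtains "v < 6" | k j where "k < 7" "j < 16" "v = node k j"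
proof (cases "v < 6")
  case False
  have "v = node ((v - 6) div 16) ((v - 6) mod 16)" "(v - 6) div 16 < 7" "(v - 6) mod 16 < 16"
    using False assms by auto
  then show ?thesis using that(2) by blast
qed (rule that(1))

lemma pair_graph_spider_graph: "pair_graph spider_graph"
proof -
  have edges: "u < 118 \<and> v < 118 \<and> u \<noteq> v" if "(u, v) \<in> edges" for u v
    using that unfolding edges_def
  proof
    assume "(u, v) \<in> set frame_edges"
    then show ?thesis using frame_edges_less[of u v] by simp
  next
    assume "(u, v) \<in> {(node k i, node k j) | k i j. k < 7 \<and> (i, j) \<in> set cell_edges}"
    then obtain k i j where "u = node k i" "v = node k j" "k < 7" "(i, j) \<in> set cell_edges"
      by blast
    then show ?thesis
      using cell_edges_less[of i j] node_less[of k i] node_less[of k j]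
        inj_on_node[of k] by (auto dest: inj_onD[of _ _ i j])
  qed
  then have "parcs spider_graph \<subseteq> {..<118} \<times> {..<118}"
    by (auto simp: spider_graph_def)
  then have "finite (parcs spider_graph)"
    by (rule finite_subset) simp
  with edges show ?thesis
    by unfold_locales (force simp: spider_graph_def symmetric_def sym_def)+
qed

text \<open>All neighbourhoods of inner vertices can therefore be read off the single list of local adjacencies.\<close>

lemma arcs_node:
  assumes "k < 7" "j < 16"
  shows "{v. (node k j, v) \<in> parcs spider_graph} = node k ` set (cell_adj j)"
proof (intro set_eqI iffI)
  fix v assume "v \<in> {v. (node k j, v) \<in> parcs spider_graph}"
  then consider "(node k j, v) \<in> set frame_edges \<or> (v, node k j) \<in> set frame_edges"
    | k' i i' where "k' < 7" "(i, i') \<in> set cell_edges \<or> (i', i) \<in> set cell_edges"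
      "node k j = node k' i" "v = node k' i'"
    unfolding spider_graph_def edges_def by fastforce
  then show "v \<in> node k ` set (cell_adj j)"
  proof cases
    case 1
    then show ?thesis
      using frame_edges_less[of "node k j" v] frame_edges_less[of v "node k j"] assms by auto
  next
    case 2
    then have "i < 19"
      using cell_edges_less[of i i'] cell_edges_less[of i' i] by auto
    with 2 have "k' = k \<and> i = j"
      using node_eq_node_inner[OF assms, of k' i] by simp
    with 2 show ?thesis
      by (auto simp: set_cell_adj)
  qed
next
  fix v assume "v \<in> node k ` set (cell_adj j)"
  then show "v \<in> {v. (node k j, v) \<in> parcs spider_graph}"
    using assms(1) unfolding spider_graph_def edges_def set_cell_adj by (auto simp: set_cell_adj simp del: node_simps)
qed

lemma spiders:
  assumes "k < 7"
  shows "spider_at (parcs spider_graph) (map (node k) [1, 2, 3, 4, 5]) (node k 0) (node k 16) (node k 17)"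
    and "spider_at (parcs spider_graph) (map (node k) [6, 7, 8, 9, 10]) (node k 0) (node k 17) (node k 18)"
    and "spider_at (parcs spider_graph) (map (node k) [11, 12, 13, 14, 15]) (node k 0) (node k 18) (node k 16)"
proof -
  note dist = distinct_map_node[OF assms]
  show "spider_at (parcs spider_graph) (map (node k) [1, 2, 3, 4, 5]) (node k 0) (node k 16) (node k 17)"
    using dist[of "[1,2,3,4,5,0,16,17]"] arcs_node[OF assms, of 1] arcs_node[OF assms, of 2]
      arcs_node[OF assms, of 3] arcs_node[OF assms, of 4] arcs_node[OF assms, of 5]
    unfolding spider_at_def cell_adj_eqs by (simp del: node_simps add: insert_commute)
  show "spider_at (parcs spider_graph) (map (node k) [6, 7, 8, 9, 10]) (node k 0) (node k 17) (node k 18)"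
    using dist[of "[6,7,8,9,10,0,17,18]"] arcs_node[OF assms, of 6] arcs_node[OF assms, of 7]
      arcs_node[OF assms, of 8] arcs_node[OF assms, of 9] arcs_node[OF assms, of 10]
    unfolding spider_at_def cell_adj_eqs by (simp del: node_simps add: insert_commute)
  show "spider_at (parcs spider_graph) (map (node k) [11, 12, 13, 14, 15]) (node k 0) (node k 18) (node k 16)"
    using dist[of "[11,12,13,14,15,0,18,16]"] arcs_node[OF assms, of 11] arcs_node[OF assms, of 12]
      arcs_node[OF assms, of 13] arcs_node[OF assms, of 14] arcs_node[OF assms, of 15]
    unfolding spider_at_def cell_adj_eqs by (simp del: node_simps add: insert_commute)
qed

section \<open>The prism has no Hamilton cycle\<close>

text \<open>Double counting of the edges of the cycle that join a copy of a frame vertex to a copy of an inner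
vertex of some cell.\<close>

lemma not_prism_hamiltonian_spider_graph: "\<not> prism_hamiltonian spider_graph"
proof
  assume "prism_hamiltonian spider_graph"
  then obtain h r where "prism_two_factor (pverts spider_graph) (parcs spider_graph) h r"
    unfolding prism_hamiltonian_def hamiltonian_def
    using hamilton_cycle_two_factor[OF pair_graph_spider_graph] by blast
  then interpret prism_two_factor "{..<118 :: nat}" "parcs spider_graph" h r
    by (simp add: spider_graph_def)
  have H_sum: "(\<Sum>b<6. H (node k j) b) = (\<Sum>i\<in>set (cell_adj j) \<inter> {16, 17, 18}. H (node k j) (node k i))"
    if "k < 7" "j < 16" for k j
  proof -
    let ?N = "{v. (node k j, v) \<in> parcs spider_graph}"
    have adj: "set (cell_adj j) \<subseteq> {..<19}"
      using cell_edges_less by (fastforce simp: set_cell_adj)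
    have "{..<6} \<inter> ?N = node k ` (set (cell_adj j) \<inter> {16, 17, 18})"
      unfolding arcs_node[OF that]
    proof (intro equalityI subsetI)
      fix v assume "v \<in> {..<6} \<inter> node k ` set (cell_adj j)"
      then obtain i where i: "i \<in> set (cell_adj j)" "v = node k i" "node k i < 6" by auto
      then have "16 \<le> i" "i < 19"
        using node_less_6_iff[OF that(1), of i] adj by auto
      then have "i \<in> {16, 17, 18}" by auto
      with i show "v \<in> node k ` (set (cell_adj j) \<inter> {16, 17, 18})" by blast
    next
      fix v assume "v \<in> node k ` (set (cell_adj j) \<inter> {16, 17, 18})"
      then show "v \<in> {..<6} \<inter> node k ` set (cell_adj j)"
        using corner_facts[OF that(1)] by auto
    qed
    moreover have "inj_on (node k) (set (cell_adj j) \<inter> {16, 17, 18})"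
      using inj_on_node[OF that(1)] adj by (auto intro: inj_on_subset)
    moreover have "(\<Sum>b<6. H (node k j) b) = (\<Sum>b\<in>{..<6} \<inter> ?N. H (node k j) b)"
      by (simp add: H_def sum.distrib sum_h_neighbours[OF _ refl, of "{..<6}" _ "node k j"] del: node_simps)
    ultimately show ?thesis
      by (simp add: sum.reindex)
  qed
  have cell: "4 \<le> (\<Sum>j<16. \<Sum>b<6. H (node k j) b)" if "k < 7" for k
  proof -
    have "{v. (node k 0, v) \<in> parcs spider_graph} =
      {node k 2, node k 5, node k 7, node k 10, node k 12, node k 15, node k 16, node k 17, node k 18}"
      using arcs_node[OF that, of 0] by (auto simp: cell_adj_eqs simp del: node_simps)
    moreover have "distinct (map (node k) [2, 5, 7, 10, 12, 15, 16, 17, 18])"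
      by (intro distinct_map_node[OF that]) simp_all
    ultimately have *: "4 \<le> H (node k 0) (node k 16) + H (node k 0) (node k 17) + H (node k 0) (node k 18)
      + (H (node k 2) (node k 16) + H (node k 3) (node k 16) + H (node k 3) (node k 17)
        + H (node k 4) (node k 17) + H (node k 5) (node k 17))
      + (H (node k 7) (node k 17) + H (node k 8) (node k 17) + H (node k 8) (node k 18)
        + H (node k 9) (node k 18) + H (node k 10) (node k 18))
      + (H (node k 12) (node k 18) + H (node k 13) (node k 18) + H (node k 13) (node k 16)
        + H (node k 14) (node k 16) + H (node k 15) (node k 16))"
      by (intro cell_crossings[OF spiders[OF that, unfolded list.map]]) simp_all
    have "(\<Sum>j<16. \<Sum>b<6. H (node k j) b) =
      (\<Sum>j<16. \<Sum>i\<in>set (cell_adj j) \<inter> {16, 17, 18}. H (node k j) (node k i))"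
      by (rule sum.cong[OF refl]) (simp only: H_sum[OF that] lessThan_iff)
    with * show ?thesis
      unfolding lessThan_16 by (simp add: cell_adj_eqs del: node_simps)
  qed
  have "28 \<le> (\<Sum>k<7. \<Sum>j<16. \<Sum>b<6. H (node k j) b)"
    using sum_mono[of "{..<7 :: nat}" "\<lambda>_. 4" "\<lambda>k. \<Sum>j<16. \<Sum>b<6. H (node k j) b"] cell by simp
  also have "\<dots> = (\<Sum>(k, j)\<in>{..<7} \<times> {..<16}. \<Sum>b<6. H (node k j) b)"
    by (rule sum.cartesian_product)
  also have "\<dots> = (\<Sum>b<6. \<Sum>(k, j)\<in>{..<7} \<times> {..<16}. H (node k j) b)"
    unfolding case_prod_unfold by (rule sum.swap)
  also have "\<dots> \<le> (\<Sum>b<6::nat. 4)"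
  proof (intro sum_mono)
    fix b :: nat assume "b \<in> {..<6}"
    let ?f = "\<lambda>(k, j). node k j"
    have inj: "inj_on ?f ({..<7} \<times> {..<16})"
    proof (rule inj_onI)
      fix a a' assume "a \<in> {..<7} \<times> {..<16}" "a' \<in> {..<7} \<times> {..<16}" "?f a = ?f a'"
      then show "a = a'"
        using node_eq_node_inner[of "fst a'" "snd a'" "fst a" "snd a"]
        by (auto simp: case_prod_unfold prod_eq_iff simp del: node_simps)
    qed
    have "(\<Sum>(k, j)\<in>{..<7} \<times> {..<16}. H (node k j) b) = (\<Sum>v\<in>?f ` ({..<7} \<times> {..<16}). H v b)"
      unfolding sum.reindex[OF inj] by (simp add: case_prod_unfold comp_def del: node_simps)
    also have "\<dots> \<le> (\<Sum>v<118. H v b)"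
    proof (rule sum_mono2)
      show "?f ` ({..<7} \<times> {..<16}) \<subseteq> {..<118}"
        using node_less by (fastforce simp del: node_simps)
    qed auto
    also have "\<dots> = (\<Sum>v<118. h False b v) + (\<Sum>v<118. h True b v)"
      by (simp add: H_def sum.distrib h_sym[of _ _ b])
    also have "\<dots> \<le> 4"
      using degree[of b False] degree[of b True] \<open>b \<in> _\<close> by simp
    finally show "(\<Sum>(k, j)\<in>{..<7} \<times> {..<16}. H (node k j) b) \<le> 4" .
  qed
  finally show False by simp
qed

section \<open>Three-connectedness\<close>

lemma three_disjoint_sets_avoid:
  assumes "card S < 3" "finite S" "A \<inter> B = {}" "A \<inter> C = {}" "B \<inter> C = {}"
  shows "S \<inter> A = {} \<or> S \<inter> B = {} \<or> S \<inter> C = {}"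
proof (rule ccontr)
  assume "\<not> ?thesis"
  then obtain a b c where abc: "a \<in> S \<inter> A" "b \<in> S \<inter> B" "c \<in> S \<inter> C" by blast
  then have "card {a, b, c} = 3"
    using assms(3-5) by (auto simp: card_insert_if)
  moreover have "card {a, b, c} \<le> card S"
    using abc assms(2) by (intro card_mono) auto
  ultimately show False using assms(1) by simp
qed

text \<open>Reachability in the subgraph induced by \<open>K\<close>, in the form to which its connectedness unfolds.\<close>

definition linked :: "'a pair_pre_digraph \<Rightarrow> 'a set \<Rightarrow> 'a \<Rightarrow> 'a \<Rightarrow> bool" where
  "linked G K u v \<longleftrightarrow> (u, v) \<in> rtrancl_on K ((arcs_ends (with_proj G \<restriction> K))\<^sup>s)"

lemma connected_iff_linked:
  "Digraph_Component.connected (with_proj G \<restriction> K) \<longleftrightarrow> K \<noteq> {} \<and> (\<forall>u\<in>K. \<forall>v\<in>K. linked G K u v)"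
  by (simp add: connected_conv linked_def)

lemma linked_refl: "u \<in> K \<Longrightarrow> linked G K u u"
  by (simp add: linked_def)

lemma linked_trans: "linked G K u v \<Longrightarrow> linked G K v w \<Longrightarrow> linked G K u w"
  unfolding linked_def by (rule rtrancl_on_trans)

lemma linked_sym: "linked G K u v \<Longrightarrow> linked G K v u"
  unfolding linked_def by (rule symD[OF rtrancl_on_sym]) (auto simp: symcl_def sym_def)

lemma linked_arc: "(u, v) \<in> parcs G \<Longrightarrow> u \<in> K \<Longrightarrow> v \<in> K \<Longrightarrow> linked G K u v"
  unfolding linked_def
  by (rule rtrancl_on_into_rtrancl_on[OF rtrancl_on_refl])
    (auto simp: symcl_def arcs_ends_conv image_iff)

lemma linked_walk:
  assumes "successively (\<lambda>u v. (u, v) \<in> parcs G) (v # ws)" "set (v # ws) \<subseteq> K"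
  shows "linked G K v (last (v # ws))"
  using assms
proof (induction ws arbitrary: v)
  case (Cons w ws)
  then have "linked G K v w" "linked G K w (last (w # ws))"
    by (auto intro: linked_arc)
  then show ?case
    by (auto intro: linked_trans)
qed (simp add: linked_refl)

text \<open>One direction of Menger's theorem: after the deletion of at most two vertices, one of three paths
that share only their start survives.\<close>

lemma linked_fan:
  assumes "finite S" "card S < 3" "v \<in> V - S"
    and ok: "\<forall>P \<in> {P1, P2, P3}. P \<noteq> [] \<and> set P \<subseteq> V \<and> successively (\<lambda>u v. (u, v) \<in> parcs G) (v # P)"
    and "set P1 \<inter> set P2 = {}" "set P1 \<inter> set P3 = {}" "set P2 \<inter> set P3 = {}"
  shows "\<exists>w \<in> {last P1, last P2, last P3}. w \<in> V - S \<and> linked G (V - S) v w"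
proof -
  obtain P where P: "P \<in> {P1, P2, P3}" "S \<inter> set P = {}"
    using three_disjoint_sets_avoid[OF assms(2,1,5-7)] by blast
  with bspec[OF ok P(1)] assms(3) have "linked G (V - S) v (last (v # P))"
    by (intro linked_walk) auto
  moreover have "last P \<in> V - S"
    using P bspec[OF ok P(1)] last_in_set[of P] by blast
  ultimately show ?thesis
    using P(1) bspec[OF ok P(1)] by auto
qed

lemma spider_linked:
  assumes "pair_graph G" and sp: "spider_at (parcs G) ns x y z" and S: "finite S" "card S < 3"
    and v: "v \<in> set ns - S"
  shows "\<exists>w \<in> {x, y, z}. w \<in> pverts G - S \<and> linked G (pverts G - S) v w"
proof -
  interpret pair_graph G by fact
  obtain s a b c d where ns: "ns = [s, a, b, c, d]" and dist: "distinct [s, a, b, c, d, x, y, z]"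
    and nb: "{v. (s, v) \<in> parcs G} = {a, b, c}" "{v. (a, v) \<in> parcs G} = {s, x, y}"
      "{v. (b, v) \<in> parcs G} = {s, y, z}" "{v. (c, v) \<in> parcs G} = {s, d, z}"
      "{v. (d, v) \<in> parcs G} = {c, x, z}"
    using sp unfolding spider_at_def by blast
  have E: "(s, v) \<in> parcs G \<longleftrightarrow> v \<in> {a, b, c}" "(a, v) \<in> parcs G \<longleftrightarrow> v \<in> {s, x, y}"
     "(b, v) \<in> parcs G \<longleftrightarrow> v \<in> {s, y, z}" "(c, v) \<in> parcs G \<longleftrightarrow> v \<in> {s, d, z}"
     "(d, v) \<in> parcs G \<longleftrightarrow> v \<in> {c, x, z}" for v
    using nb by blast+
  have V: "{s, a, b, c, d, x, y, z} \<subseteq> pverts G"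
    using in_arcsD1[of s a] in_arcsD2[of s a] in_arcsD2[of s b] in_arcsD2[of s c] in_arcsD2[of c d]
      in_arcsD2[of a x] in_arcsD2[of a y] in_arcsD2[of c z] by (simp add: E)
  have fan: "\<exists>w \<in> {x, y, z}. w \<in> pverts G - S \<and> linked G (pverts G - S) v w"
    if "v \<in> pverts G - S" "{last P1, last P2, last P3} = {x, y, z}"
      "P1 \<noteq> []" "P2 \<noteq> []" "P3 \<noteq> []" "set P1 \<union> set P2 \<union> set P3 \<subseteq> {s, a, b, c, d, x, y, z}"
      "successively (\<lambda>u v. (u, v) \<in> parcs G) (v # P1)"
      "successively (\<lambda>u v. (u, v) \<in> parcs G) (v # P2)"
      "successively (\<lambda>u v. (u, v) \<in> parcs G) (v # P3)"
      "set P1 \<inter> set P2 = {}" "set P1 \<inter> set P3 = {}" "set P2 \<inter> set P3 = {}" for v P1 P2 P3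
  proof -
    have "\<forall>P \<in> {P1, P2, P3}. P \<noteq> [] \<and> set P \<subseteq> pverts G \<and>
        successively (\<lambda>u v. (u, v) \<in> parcs G) (v # P)"
      using that(3-9) V by blast
    from linked_fan[OF S that(1) this that(10-12)] show ?thesis
      unfolding that(2) .
  qed
  consider "v = s" | "v = a" | "v = b" | "v = c" | "v = d"
    using v ns by auto
  then show ?thesis
  proof cases
    case 1
    then show ?thesis
      using dist V v by (intro fan[of v "[a, x]" "[b, y]" "[c, z]"]) (auto simp: E ns)
  next
    case 2
    then show ?thesis
      using dist V v by (intro fan[of v "[x]" "[y]" "[s, b, z]"]) (auto simp: E ns)
  next
    case 3
    then show ?thesis
      using dist V v by (intro fan[of v "[y]" "[z]" "[s, a, x]"]) (auto simp: E ns)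
  next
    case 4
    then show ?thesis
      using dist V v by (intro fan[of v "[z]" "[d, x]" "[s, a, y]"]) (auto simp: E ns)
  next
    case 5
    then show ?thesis
      using dist V v by (intro fan[of v "[x]" "[z]" "[c, s, a, y]"]) (auto simp: E ns)
  qed
qed

text \<open>A surviving pole dominates the rest of the frame; if both poles are deleted, then nothing else is
and the path remains.\<close>

lemma frame_linked:
  assumes "finite S" "card S < 3" "b \<in> {..<6} - S" "b' \<in> {..<6} - S"
  shows "linked spider_graph ({..<118} - S) b b'"
proof -
  let ?L = "linked spider_graph ({..<118} - S)"
  have arc: "?L u v"
    if "(u, v) \<in> set frame_edges \<or> (v, u) \<in> set frame_edges" "u \<notin> S" "v \<notin> S" for u v
    using that frame_edges_less[of u v] frame_edges_less[of v u]
    by (intro linked_arc) (auto simp: spider_graph_def edges_def)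
  have pole: "?L b b'" if "p \<notin> S" "p < 2" for p
  proof -
    have "?L p u" if "u \<in> {..<6} - S" for u
    proof (cases "u = p")
      case True
      with \<open>p < 2\<close> \<open>p \<notin> S\<close> show ?thesis by (simp add: linked_refl)
    next
      case False
      have "u \<in> {0, 1, 2, 3, 4, 5}" "p \<in> {0, 1}" using that \<open>p < 2\<close> by auto
      with False that \<open>p \<notin> S\<close> show ?thesis
        by (intro arc) (auto simp: frame_edges_def)
    qed
    then show ?thesis
      using assms(3,4) by (meson linked_sym linked_trans)
  qed
  show ?thesis
  proof (cases "0 \<in> S \<and> 1 \<in> S")
    case False
    then show ?thesis using pole[of 0] pole[of 1] by auto
  next
    case True
    have "S = {0, 1}"
      using True assms(1,2) card_seteq[of S "{0, 1}"] by auto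
    then have b: "b \<in> {2, 3, 4, 5}" "b' \<in> {2, 3, 4, 5}"
      using assms(3,4) by auto
    have "?L 2 2"
      using \<open>S = {0, 1}\<close> by (intro linked_refl) simp
    moreover have "?L 2 3" "?L 3 4" "?L 4 5"
      by (rule arc; simp add: frame_edges_def \<open>S = {0, 1}\<close>)+
    moreover from this have "?L 2 4"
      by (meson linked_trans)
    moreover from this \<open>?L 4 5\<close> have "?L 2 5"
      by (rule linked_trans)
    ultimately have "?L 2 u" if "u \<in> {2, 3, 4, 5}" for u
      using that by auto
    from linked_trans[OF linked_sym[OF this] this] show ?thesis
      using b by blast
  qed
qed

lemma k_connected_spider_graph: "k_connected 3 spider_graph"
proof -
  interpret pair_graph spider_graph by (rule pair_graph_spider_graph)
  have "Digraph_Component.connected (with_proj spider_graph \<restriction> ({..<118} - S))"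
    if "S \<subseteq> {..<118}" and card: "card S < 3" for S
  proof -
    have fin: "finite S"
      using that finite_subset by blast
    let ?L = "linked spider_graph ({..<118} - S)"
    have V: "pverts spider_graph = {..<118}"
      by (simp add: spider_graph_def)
    have corners: "{node k 16, node k 17, node k 18} \<subseteq> {..<6}" if "k < 7" for k
      using corner_facts[OF that] by auto
    have centre: "\<exists>b \<in> {..<6} - S. ?L (node k 0) b" if k: "k < 7" and "node k 0 \<notin> S" for k
    proof -
      have arc: "(node k 0, v) \<in> parcs spider_graph" if "v \<in> {node k 16, node k 17, node k 18}" for v
        using arcs_node[OF k, of 0] that by (auto simp: cell_adj_eqs simp del: node_simps)
      have dist: "distinct (map (node k) [16, 17, 18])"
        by (intro distinct_map_node[OF k]) simp_all
      have v: "node k 0 \<in> {..<118} - S"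
        using node_less[OF k, of 0] \<open>node k 0 \<notin> S\<close> by simp
      have sub: "{node k 16, node k 17, node k 18} \<subseteq> {..<118}"
        using corners[OF k] by (rule subset_trans) auto
      have "\<exists>w \<in> {last [node k 16], last [node k 17], last [node k 18]}.
          w \<in> {..<118} - S \<and> ?L (node k 0) w"
        by (intro linked_fan[OF fin card v])
          (use arc dist sub in \<open>simp_all del: node_simps\<close>)
      then have "\<exists>w \<in> {node k 16, node k 17, node k 18}. w \<in> {..<118} - S \<and> ?L (node k 0) w"
        by (simp only: last.simps if_True simp_thms)
      then show ?thesis
        using corners[OF k] by blast
    qed
    have to_frame: "\<exists>b \<in> {..<6} - S. ?L v b" if v: "v \<in> {..<118} - S" for v
    proof -
      from v have "v < 118" by simp
      then show ?thesis
      proof (cases rule: vertex_cases)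
        case 1
        then show ?thesis
          using v linked_refl[OF v, of spider_graph] by auto
      next
        case (2 k j)
        show ?thesis
        proof (cases "j = 0")
          case True
          then show ?thesis using centre[OF 2(1)] 2 v by simp
        next
          case False
          moreover have "j \<in> {..<16}"
            using 2(2) by simp
          ultimately have "j \<in> set [1, 2, 3, 4, 5] \<union> set [6, 7, 8, 9, 10] \<union> set [11, 12, 13, 14, 15]"
            unfolding lessThan_16 by auto
          then have "v \<in> set (map (node k) [1, 2, 3, 4, 5]) \<or> v \<in> set (map (node k) [6, 7, 8, 9, 10])
            \<or> v \<in> set (map (node k) [11, 12, 13, 14, 15])"
            unfolding 2(3) by (auto simp del: node_simps)
          then obtain w where w: "w = node k 0 \<or> w \<in> {node k 16, node k 17, node k 18}"
            "w \<in> {..<118} - S" "?L v w"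
            using spider_linked[OF pair_graph_spider_graph spiders(1)[OF 2(1)] fin card, of v]
              spider_linked[OF pair_graph_spider_graph spiders(2)[OF 2(1)] fin card, of v]
              spider_linked[OF pair_graph_spider_graph spiders(3)[OF 2(1)] fin card, of v] v
            unfolding V by blast
          from w(1) show ?thesis
          proof
            assume "w = node k 0"
            then obtain b where "b \<in> {..<6} - S" "?L w b"
              using centre[OF 2(1)] w(2) by auto
            then show ?thesis
              using linked_trans[OF w(3)] by blast
          next
            assume "w \<in> {node k 16, node k 17, node k 18}"
            then show ?thesis
              using corners[OF 2(1)] w(2,3) by blast
          qed
        qed
      qed
    qed
    have "?L u v" if uv: "u \<in> {..<118} - S" "v \<in> {..<118} - S" for u v
    proof -
      obtain b b' where "b \<in> {..<6} - S" "?L u b" "b' \<in> {..<6} - S" "?L v b'"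
        using to_frame[OF uv(1)] to_frame[OF uv(2)] by blast
      then show ?thesis
        using frame_linked[OF fin card] by (meson linked_sym linked_trans)
    qed
    moreover have "{..<118} - S \<noteq> {}"
    proof
      assume "{..<118} - S = {}"
      then have "card {..<118 :: nat} \<le> card S"
        using fin by (intro card_mono) auto
      with card show False by simp
    qed
    ultimately show ?thesis
      unfolding connected_iff_linked by blast
  qed
  then show ?thesis
    by (simp add: k_connected_def spider_graph_def)
qed

section \<open>Straight-line drawings\<close>

text \<open>Twice the signed area of the triangle \<open>p q r\<close>. It is kept polymorphic so that the conditions on
segments can be evaluated over the integers and then transferred to the reals.\<close>

definition cross :: "'a::comm_ring_1 \<times> 'a \<Rightarrow> 'a \<times> 'a \<Rightarrow> 'a \<times> 'a \<Rightarrow> 'a" where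
  "cross p q r = (fst q - fst p) * (snd r - snd p) - (snd q - snd p) * (fst r - fst p)"

lemma cross_combination:
  fixes p q r s :: "real \<times> real"
  shows "cross p q ((1 - t) *\<^sub>R r + t *\<^sub>R s) = (1 - t) * cross p q r + t * cross p q s"
  by (simp add: cross_def algebra_simps)

lemma cross_same [simp]: "cross p q p = 0" "cross p q q = 0" "cross p p q = 0"
  by (simp_all add: cross_def)

text \<open>The second alternative covers collinear points with \<open>p\<close> between the other two, which occurs for
successive edges of the path in the frame.\<close>

definition diverge :: "'a::linordered_idom \<times> 'a \<Rightarrow> 'a \<times> 'a \<Rightarrow> 'a \<times> 'a \<Rightarrow> bool" where
  "diverge p q r \<longleftrightarrow> cross p q r \<noteq> 0 \<or>
    (fst q - fst p) * (fst r - fst p) + (snd q - snd p) * (snd r - snd p) < 0"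

text \<open>A computable criterion for disjoint segments: the line through one of them has the other strictly on one side, or a
vertical line separates them, which is needed for collinear segments.\<close>

definition apart :: "'a::linordered_idom \<times> 'a \<Rightarrow> 'a \<times> 'a \<Rightarrow> 'a \<times> 'a \<Rightarrow> 'a \<times> 'a \<Rightarrow> bool" where
  "apart p q r s \<longleftrightarrow> 0 < cross p q r * cross p q s \<or> 0 < cross r s p * cross r s q \<or>
    max (fst p) (fst q) < min (fst r) (fst s) \<or> max (fst r) (fst s) < min (fst p) (fst q)"

text \<open>Along the second segment the signed area with respect to \<open>p q\<close> is a convex combination of two numbers of
the same sign, whereas it vanishes on the first segment.\<close>

lemma disjoint_segments_one_side:
  fixes p q r s :: "real \<times> real"
  assumes "0 < cross p q r * cross p q s"
  shows "closed_segment p q \<inter> closed_segment r s = {}"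
proof (rule ccontr)
  assume "\<not> ?thesis"
  then obtain z t t' where z: "z = (1 - t) *\<^sub>R p + t *\<^sub>R q" "z = (1 - t') *\<^sub>R r + t' *\<^sub>R s"
    and t': "0 \<le> t'" "t' \<le> 1"
    unfolding closed_segment_def by blast
  have "cross p q z = 0"
    unfolding z(1) cross_combination by simp
  then have "(1 - t') * cross p q r + t' * cross p q s = 0"
    unfolding z(2) cross_combination .
  moreover have "(1 - t') * x + t' * y > 0" if "x > 0" "y > 0" for x y
    using t' that by (cases "t' = 0") (auto intro: add_nonneg_pos)
  from this[of "cross p q r" "cross p q s"] this[of "- cross p q r" "- cross p q s"]
  have "(1 - t') * cross p q r + t' * cross p q s \<noteq> 0"
    using assms by (auto simp: zero_less_mult_iff)
  ultimately show False by simp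
qed

lemma fst_closed_segment_bounds:
  fixes p q :: "real \<times> real"
  assumes "z \<in> closed_segment p q"
  shows "min (fst p) (fst q) \<le> fst z" "fst z \<le> max (fst p) (fst q)"
proof -
  obtain t where t: "0 \<le> t" "t \<le> 1" "z = (1 - t) *\<^sub>R p + t *\<^sub>R q"
    using assms unfolding closed_segment_def by blast
  show "fst z \<le> max (fst p) (fst q)"
    using convex_bound_le[of "fst p" "max (fst p) (fst q)" "fst q" "1 - t" t] t by simp
  show "min (fst p) (fst q) \<le> fst z"
    using convex_bound_le[of "- fst p" "- min (fst p) (fst q)" "- fst q" "1 - t" t] t by simp
qed

lemma disjoint_segments_apart:
  fixes p q r s :: "real \<times> real"
  assumes "apart p q r s"
  shows "closed_segment p q \<inter> closed_segment r s = {}"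
proof -
  have False if z: "z \<in> closed_segment p q" "z \<in> closed_segment r s" for z
    using assms unfolding apart_def
  proof (elim disjE)
    assume "0 < cross p q r * cross p q s"
    from disjoint_segments_one_side[OF this] z show False by blast
  next
    assume "0 < cross r s p * cross r s q"
    from disjoint_segments_one_side[OF this] z show False by blast
  qed (use fst_closed_segment_bounds[OF z(1)] fst_closed_segment_bounds[OF z(2)] in linarith)+
  then show ?thesis by blast
qed

lemma segments_common_end:
  fixes p q r :: "real \<times> real"
  assumes "diverge p q r"
  shows "closed_segment p q \<inter> closed_segment p r \<subseteq> {p}"
proof
  fix z assume "z \<in> closed_segment p q \<inter> closed_segment p r"
  then obtain t t' where z: "z = (1 - t) *\<^sub>R p + t *\<^sub>R q" "z = (1 - t') *\<^sub>R p + t' *\<^sub>R r"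
    and t: "0 \<le> t" "0 \<le> t'"
    unfolding closed_segment_def by blast
  have "t' = 0"
  proof (cases "cross p q r = 0")
    case False
    have "cross p q z = 0"
      unfolding z(1) cross_combination by simp
    then have "t' * cross p q r = 0"
      unfolding z(2) cross_combination by simp
    with False show ?thesis by simp
  next
    case True
    let ?dot = "\<lambda>w. (fst q - fst p) * (fst w - fst p) + (snd q - snd p) * (snd w - snd p)"
    have "?dot r < 0"
      using assms True by (simp add: diverge_def)
    have "?dot z = t * ((fst q - fst p)\<^sup>2 + (snd q - snd p)\<^sup>2)"
      unfolding z(1) by (simp add: algebra_simps power2_eq_square)
    then have "0 \<le> ?dot z"
      using t by simp
    moreover have "?dot z = t' * ?dot r"
      unfolding z(2) by (simp add: algebra_simps)
    ultimately have "0 \<le> t' * ?dot r" by simp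
    with \<open>?dot r < 0\<close> t(2) show ?thesis
      by (simp add: zero_le_mult_iff)
  qed
  then show "z \<in> {p}"
    using z(2) by simp
qed

definition segments_meet_properly ::
    "('v \<Rightarrow> 'a::linordered_idom \<times> 'a) \<Rightarrow> 'v \<times> 'v \<Rightarrow> 'v \<times> 'v \<Rightarrow> bool" where
  "segments_meet_properly f = (\<lambda>(i, j) (i', j').
    if i = i' then j = j' \<or> diverge (f i) (f j) (f j')
    else if j = j' then diverge (f j) (f i) (f i')
    else if i = j' then j = i' \<or> diverge (f i) (f j) (f i')
    else if j = i' then diverge (f j) (f i) (f j')
    else apart (f i) (f j) (f i') (f j'))"

abbreviation real_point :: "int \<times> int \<Rightarrow> real \<times> real" where
  "real_point p \<equiv> (real_of_int (fst p), real_of_int (snd p))"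

lemma cross_real_point: "cross (real_point p) (real_point q) (real_point r) = real_of_int (cross p q r)"
  by (simp add: cross_def)

lemma segments_meet_properly_real_point:
  "segments_meet_properly (\<lambda>v. real_point (f v)) e e' \<longleftrightarrow> segments_meet_properly f e e'"
  unfolding segments_meet_properly_def apart_def diverge_def cross_real_point fst_conv snd_conv
    of_int_mult[symmetric] of_int_diff[symmetric] of_int_add[symmetric]
    of_int_max[symmetric] of_int_min[symmetric] of_int_less_iff
    of_int_0_less_iff of_int_less_0_iff of_int_eq_0_iff ..

lemma segments_meet_properlyD:
  fixes f :: "'v \<Rightarrow> real \<times> real"
  assumes "segments_meet_properly f (i, j) (i', j')" "{i, j} \<noteq> {i', j'}"
  shows "closed_segment (f i) (f j) \<inter> closed_segment (f i') (f j') \<subseteq> f ` ({i, j} \<inter> {i', j'})"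
proof -
  consider "i = i'" "j \<noteq> j'" | "i \<noteq> i'" "j = j'" | "i \<noteq> i'" "j \<noteq> j'" "i = j'" "j \<noteq> i'"
    | "i \<noteq> i'" "j \<noteq> j'" "i \<noteq> j'" "j = i'" | "i \<noteq> i'" "j \<noteq> j'" "i \<noteq> j'" "j \<noteq> i'"
    using assms(2) by blast
  then show ?thesis
  proof cases
    case 1
    with assms(1) segments_common_end[of "f i" "f j" "f j'"] show ?thesis
      by (auto simp: segments_meet_properly_def)
  next
    case 2
    with assms(1) segments_common_end[of "f j" "f i" "f i'"] show ?thesis
      by (auto simp: segments_meet_properly_def closed_segment_commute)
  next
    case 3
    with assms(1) segments_common_end[of "f i" "f j" "f i'"] show ?thesis
      by (auto simp: segments_meet_properly_def closed_segment_commute)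
  next
    case 4
    with assms(1) segments_common_end[of "f j" "f i" "f j'"] show ?thesis
      by (auto simp: segments_meet_properly_def closed_segment_commute)
  next
    case 5
    with assms(1) disjoint_segments_apart show ?thesis
      by (auto simp: segments_meet_properly_def)
  qed
qed

text \<open>That an edge avoids all vertices other than its ends is a consequence of the condition on pairs of
edges: such a vertex would lie on an edge of its own that meets the given one in a point
that is not a common end.\<close>

lemma planar_straight_line:
  fixes pos :: "'a \<Rightarrow> real \<times> real"
  assumes "pair_graph G" and inj: "inj_on pos (pverts G)"
    and nonisolated: "\<And>v. v \<in> pverts G \<Longrightarrow> \<exists>w. (v, w) \<in> parcs G"
    and meet: "\<And>u v x y. (u, v) \<in> parcs G \<Longrightarrow> (x, y) \<in> parcs G \<Longrightarrow> {u, v} \<noteq> {x, y} \<Longrightarrow>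
      closed_segment (pos u) (pos v) \<inter> closed_segment (pos x) (pos y) \<subseteq> pos ` ({u, v} \<inter> {x, y})"
  shows "planar G"
proof -
  interpret pair_graph G by fact
  have neq: "u \<noteq> v" if "(u, v) \<in> parcs G" for u v
    using no_loops that by force
  have "w \<in> {u, v}" if uv: "(u, v) \<in> parcs G" and w: "w \<in> pverts G" "pos w \<in> closed_segment (pos u) (pos v)"
    for u v w
  proof (rule ccontr)
    assume notin: "w \<notin> {u, v}"
    obtain w' where w': "(w, w') \<in> parcs G"
      using nonisolated[OF w(1)] by blast
    have "pos w \<in> closed_segment (pos w) (pos w') \<inter> closed_segment (pos u) (pos v)"
      using w(2) by simp
    then have "pos w \<in> pos ` ({w, w'} \<inter> {u, v})"
      using meet[OF w' uv] notin by blast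
    then obtain q where "q \<in> {u, v}" "pos w = pos q" by blast
    then show False
      using inj w(1) notin in_arcsD1[OF uv] in_arcsD2[OF uv] by (auto dest: inj_onD)
  qed
  moreover have "pos u \<noteq> pos v" if "(u, v) \<in> parcs G" for u v
    using inj_onD[OF inj] neq[OF that] in_arcsD1[OF that] in_arcsD2[OF that] by blast
  ultimately have "plane_drawing G pos (\<lambda>(u, v). linepath (pos u) (pos v))"
    unfolding plane_drawing_def
  proof (intro conjI)
    show "\<forall>(u, v)\<in>parcs G. \<forall>(x, y)\<in>parcs G. {u, v} \<noteq> {x, y} \<longrightarrow>
       path_image ((\<lambda>(u, v). linepath (pos u) (pos v)) (u, v)) \<inter>
       path_image ((\<lambda>(u, v). linepath (pos u) (pos v)) (x, y)) \<subseteq> pos ` ({u, v} \<inter> {x, y})"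
      unfolding case_prod_beta
      by (intro ballI impI, simp only: path_image_linepath fst_conv snd_conv, rule meet) simp_all
  qed (use inj in \<open>auto simp: closed_segment_commute\<close>)
  then show ?thesis
    unfolding planar_def by blast
qed

section \<open>Drawing the graph\<close>

text \<open>The poles lie on the vertical axis at heights \<open>1\<close> and \<open>-1\<close>, the path on the horizontal axis. The
first bounded face has both poles as corners, and the other six lie between consecutive rays from a pole.\<close>

definition frame_point :: "nat \<Rightarrow> int \<times> int" where
  "frame_point v = [(0, 1), (0, -1), (1, 0), (2, 0), (3, 0), (4, 0)] ! v"

text \<open>A drawing of a cell in the triangle with vertices \<open>(0, 0)\<close>, \<open>(18, 0)\<close>, \<open>(0, 18)\<close>. The centre is its barycentre, and
the three spiders are images of one drawing under the affine maps that permute the corners cyclically.\<close>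

definition cell_point :: "nat \<Rightarrow> int \<times> int" where
  "cell_point j = [(6, 6), (13, 1), (5, 2), (10, 1), (6, 3), (11, 2), (4, 13), (11, 5), (7, 10),
    (9, 6), (5, 11), (1, 4), (2, 11), (1, 7), (3, 9), (2, 5), (0, 0), (18, 0), (0, 18)] ! j"

lemma frame_segments_meet_properly:
  "e \<in> set frame_edges \<Longrightarrow> e' \<in> set frame_edges \<Longrightarrow> segments_meet_properly frame_point e e'"
proof -
  have "\<forall>e \<in> set frame_edges. \<forall>e' \<in> set frame_edges. segments_meet_properly frame_point e e'"
    by code_simp
  then show "e \<in> set frame_edges \<Longrightarrow> e' \<in> set frame_edges \<Longrightarrow> segments_meet_properly frame_point e e'"
    by blast
qed

lemma cell_segments_meet_properly:
  "e \<in> set cell_edges \<Longrightarrow> e' \<in> set cell_edges \<Longrightarrow> segments_meet_properly cell_point e e'"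
proof -
  have "\<forall>e \<in> set cell_edges. \<forall>e' \<in> set cell_edges. segments_meet_properly cell_point e e'"
    by code_simp
  then show "e \<in> set cell_edges \<Longrightarrow> e' \<in> set cell_edges \<Longrightarrow> segments_meet_properly cell_point e e'"
    by blast
qed

text \<open>The affine map from the triangle of \<open>cell_point\<close> onto the \<open>k\<close>th face of the frame.\<close>

definition place :: "nat \<Rightarrow> real \<times> real \<Rightarrow> real \<times> real" where
  "place k z = (let a = real_point (frame_point (corner k 0)); b = real_point (frame_point (corner k 1));
      c = real_point (frame_point (corner k 2)) in
    a + (fst z / 18) *\<^sub>R (b - a) + (snd z / 18) *\<^sub>R (c - a))"

lemma place_combination:
  "place k ((1 - t) *\<^sub>R p + t *\<^sub>R q) = (1 - t) *\<^sub>R place k p + t *\<^sub>R place k q"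
  by (simp add: place_def Let_def prod_eq_iff field_simps)

lemma place_eqs:
  "place 0 (x, y) = (y / 18, 1 - x / 9 - y / 18)"
  "place 1 (x, y) = (x / 18 + y / 9, 1 - x / 18 - y / 18)"
  "place 2 (x, y) = (x / 9 + y / 6, 1 - x / 18 - y / 18)"
  "place 3 (x, y) = (x / 6 + 2 * y / 9, 1 - x / 18 - y / 18)"
  "place 4 (x, y) = (x / 18 + y / 9, - 1 + x / 18 + y / 18)"
  "place 5 (x, y) = (x / 9 + y / 6, - 1 + x / 18 + y / 18)"
  "place 6 (x, y) = (x / 6 + 2 * y / 9, - 1 + x / 18 + y / 18)"
  by (simp_all add: place_def corner_def frame_point_def)

lemma less_7_cases:
  assumes "k < (7 :: nat)"
  obtains "k = 0" | "k = 1" | "k = 2" | "k = 3" | "k = 4" | "k = 5" | "k = 6"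
  using assms by linarith

lemma inj_place: "k < 7 \<Longrightarrow> place k z = place k w \<Longrightarrow> z = w"
  by (erule less_7_cases; cases z; cases w) (auto simp: place_eqs place_eqs(2)[unfolded One_nat_def])

text \<open>The interior of the \<open>k\<close>th face. A ray from a pole to the point \<open>(m, 0)\<close> consists of points with
\<open>x = m * (1 - \<bar>y\<bar>)\<close>, so the quotient of \<open>x\<close> by \<open>1 - \<bar>y\<bar>\<close> tells the faces at one pole apart and the sign of \<open>y\<close>
tells the poles apart; this makes disjointness evident.\<close>

definition region :: "nat \<Rightarrow> (real \<times> real) set" where
  "region k = {(x, y). (let m = [0, 1, 2, 3, 1, 2, 3] ! k; d = 1 - \<bar>y\<bar> in m * d < x \<and> x < (m + 1) * d) \<and>
    [True, 0 < y, 0 < y, 0 < y, y < 0, y < 0, y < 0] ! k}"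

lemma region_eqs:
  "(x, y) \<in> region 0 \<longleftrightarrow> 0 < x \<and> x < 1 - \<bar>y\<bar>"
  "(x, y) \<in> region 1 \<longleftrightarrow> 1 - \<bar>y\<bar> < x \<and> x < 2 * (1 - \<bar>y\<bar>) \<and> 0 < y"
  "(x, y) \<in> region 2 \<longleftrightarrow> 2 * (1 - \<bar>y\<bar>) < x \<and> x < 3 * (1 - \<bar>y\<bar>) \<and> 0 < y"
  "(x, y) \<in> region 3 \<longleftrightarrow> 3 * (1 - \<bar>y\<bar>) < x \<and> x < 4 * (1 - \<bar>y\<bar>) \<and> 0 < y"
  "(x, y) \<in> region 4 \<longleftrightarrow> 1 - \<bar>y\<bar> < x \<and> x < 2 * (1 - \<bar>y\<bar>) \<and> y < 0"
  "(x, y) \<in> region 5 \<longleftrightarrow> 2 * (1 - \<bar>y\<bar>) < x \<and> x < 3 * (1 - \<bar>y\<bar>) \<and> y < 0"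
  "(x, y) \<in> region 6 \<longleftrightarrow> 3 * (1 - \<bar>y\<bar>) < x \<and> x < 4 * (1 - \<bar>y\<bar>) \<and> y < 0"
  by (simp_all add: region_def Let_def)

lemma place_in_region:
  assumes "k < 7" "0 < x" "0 < y" "x + y < 18"
  shows "place k (x, y) \<in> region k"
proof -
  have abs: "\<bar>1 - x / 18 - y / 18\<bar> = 1 - x / 18 - y / 18"
    "\<bar>- 1 + x / 18 + y / 18\<bar> = 1 - x / 18 - y / 18"
    using assms(2-4) by linarith+
  have "k = 0 \<Longrightarrow> ?thesis"
    using assms(2-4) by (simp add: place_eqs region_eqs abs_if)
  moreover have "place 1 (x, y) \<in> region 1" "place 2 (x, y) \<in> region 2"
    "place 3 (x, y) \<in> region 3" "place 4 (x, y) \<in> region 4" "place 5 (x, y) \<in> region 5"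
    "place 6 (x, y) \<in> region 6"
    using assms(2-4) unfolding place_eqs region_eqs abs by simp_all
  ultimately show ?thesis
    using assms(1) by (elim less_7_cases) simp_all
qed

lemma regions_disjoint:
  assumes "k < 7" "k' < 7" "z \<in> region k" "z \<in> region k'"
  shows "k = k'"
proof -
  obtain x y where z: "z = (x, y)" by (cases z)
  show ?thesis
    using assms(1,2)
    by (elim less_7_cases; use assms(3,4) in \<open>auto simp: z region_eqs region_eqs(2)[unfolded One_nat_def]\<close>)
qed

lemma frame_segment_not_region:
  assumes "(u, v) \<in> set frame_edges" "k < 7"
    and z: "z \<in> closed_segment (real_point (frame_point u)) (real_point (frame_point v))"
  shows "z \<notin> region k"
proof -
  obtain t where t: "0 \<le> t" "t \<le> 1"
    "z = (1 - t) *\<^sub>R real_point (frame_point u) + t *\<^sub>R real_point (frame_point v)"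
    using z unfolding closed_segment_def by blast
  show ?thesis
    using assms(2)
    by (rule less_7_cases;
        use assms(1) t in \<open>auto simp: frame_edges_def frame_point_def region_eqs region_eqs(2)[unfolded One_nat_def]\<close>)
qed

definition position :: "nat \<Rightarrow> real \<times> real" where
  "position v = (if v < 6 then real_point (frame_point v)
    else place ((v - 6) div 16) (real_point (cell_point ((v - 6) mod 16))))"

lemma cell_point_interior:
  assumes "j < 16"
  shows "0 < fst (cell_point j)" "0 < snd (cell_point j)" "fst (cell_point j) + snd (cell_point j) < 18"
proof -
  have "\<forall>j \<in> set [0..<16]. 0 < fst (cell_point j) \<and> 0 < snd (cell_point j) \<and>
    fst (cell_point j) + snd (cell_point j) < 18"
    by code_simp
  then show "0 < fst (cell_point j)" "0 < snd (cell_point j)" "fst (cell_point j) + snd (cell_point j) < 18"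
    using assms by auto
qed

lemma cell_point_triangle:
  assumes "j < 19"
  shows "0 \<le> fst (cell_point j)" "0 \<le> snd (cell_point j)" "fst (cell_point j) + snd (cell_point j) \<le> 18"
proof -
  have "\<forall>j \<in> set [0..<19]. 0 \<le> fst (cell_point j) \<and> 0 \<le> snd (cell_point j) \<and>
    fst (cell_point j) + snd (cell_point j) \<le> 18"
    by code_simp
  then show "0 \<le> fst (cell_point j)" "0 \<le> snd (cell_point j)" "fst (cell_point j) + snd (cell_point j) \<le> 18"
    using assms by auto
qed

lemma inj_on_cell_point: "inj_on cell_point {..<16}"
proof -
  have "distinct (map cell_point [0..<16])" by code_simp
  then show ?thesis
    by (simp add: distinct_map atLeast_upt)
qed

lemma inj_on_frame_point: "inj_on frame_point {..<6}"
proof -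
  have "distinct (map frame_point [0..<6])" by code_simp
  then show ?thesis
    by (simp add: distinct_map atLeast_upt)
qed

lemma position_node:
  assumes "k < 7" "j < 19"
  shows "position (node k j) = place k (real_point (cell_point j))"
proof (cases "j < 16")
  case True
  then have "(node k j - 6) div 16 = k" "(node k j - 6) mod 16 = j" "\<not> node k j < 6"
    by simp_all
  then show ?thesis
    unfolding position_def by simp
next
  case False
  then have "node k j < 6"
    using node_less_6_iff[OF assms] by simp
  then have "position (node k j) = real_point (frame_point (node k j))"
    by (simp add: position_def)
  moreover have "j = 16 \<or> j = 17 \<or> j = 18"
    using False assms(2) by auto
  ultimately show ?thesis
    by (auto simp: place_def Let_def cell_point_def prod_eq_iff diff_divide_distrib)
qed

lemma frame_point_not_region:
  assumes "b < 6" "k < 7"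
  shows "position b \<notin> region k"
proof -
  obtain u v where "(u, v) \<in> set frame_edges" "b = u \<or> b = v"
    by (rule frame_vertex_edge[OF assms(1)])
  then show ?thesis
    using frame_segment_not_region[of u v k "position b"] assms by (auto simp: position_def)
qed

lemma inner_position_in_region:
  assumes "k < 7" "j < 16"
  shows "position (node k j) \<in> region k"
  using place_in_region[OF assms(1), of "real_of_int (fst (cell_point j))" "real_of_int (snd (cell_point j))"]
    cell_point_interior[OF assms(2)] position_node[of k j] assms
  by (simp del: node_simps)

lemma inj_on_position: "inj_on position {..<118}"
proof (rule inj_onI)
  fix u v assume "u \<in> {..<118 :: nat}" "v \<in> {..<118 :: nat}" and eq: "position u = position v"
  then have "u < 118" "v < 118" by simp_all
  from \<open>u < 118\<close> show "u = v"
  proof (cases rule: vertex_cases)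
    case u: 1
    from \<open>v < 118\<close> show ?thesis
    proof (cases rule: vertex_cases)
      case 1
      then show ?thesis
        using u eq inj_onD[OF inj_on_frame_point, of u v] by (simp add: position_def prod_eq_iff)
    next
      case (2 k j)
      then show ?thesis
        using frame_point_not_region[OF u, of k] inner_position_in_region[of k j] eq by simp
    qed
  next
    case u: (2 k j)
    from \<open>v < 118\<close> show ?thesis
    proof (cases rule: vertex_cases)
      case 1
      then show ?thesis
        using frame_point_not_region[OF 1 u(1)] inner_position_in_region[OF u(1,2)] eq u(3) by simp
    next
      case (2 k' j')
      have "k = k'"
        using regions_disjoint[OF u(1) 2(1)] inner_position_in_region[OF u(1,2)]
          inner_position_in_region[OF 2(1,2)] eq u(3) 2(3) by simp
      have "place k (real_point (cell_point j)) = place k (real_point (cell_point j'))"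
        using eq position_node[OF u(1), of j] position_node[OF u(1), of j'] u(2,3) 2(2,3) \<open>k = k'\<close>
        by (simp del: node_simps)
      then have "real_point (cell_point j) = real_point (cell_point j')"
        by (rule inj_place[OF u(1)])
      then have "j = j'"
        using inj_onD[OF inj_on_cell_point, of j j'] u(2) 2(2) by (simp add: prod_eq_iff)
      then show ?thesis
        using u(3) 2(3) \<open>k = k'\<close> by simp
    qed
  qed
qed

lemma cell_segment_image:
  assumes "k < 7" "i < 19" "j < 19" "z \<in> closed_segment (position (node k i)) (position (node k j))"
  obtains w where "z = place k w"
    "w \<in> closed_segment (real_point (cell_point i)) (real_point (cell_point j))"
proof -
  let ?p = "real_point (cell_point i)" and ?q = "real_point (cell_point j)"
  obtain t where t: "0 \<le> t" "t \<le> 1" "z = (1 - t) *\<^sub>R place k ?p + t *\<^sub>R place k ?q"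
    using assms(4) unfolding closed_segment_def position_node[OF assms(1,2)] position_node[OF assms(1,3)]
    by blast
  show thesis
  proof
    show "z = place k ((1 - t) *\<^sub>R ?p + t *\<^sub>R ?q)"
      unfolding place_combination by (rule t(3))
    show "(1 - t) *\<^sub>R ?p + t *\<^sub>R ?q \<in> closed_segment ?p ?q"
      unfolding closed_segment_def using t(1,2) by blast
  qed
qed

text \<open>The first end \<open>i\<close> is always an inner vertex, so only the other end of the segment can lie on the
boundary of the triangle. As a consequence different cells can only meet in frame vertices.\<close>

lemma cell_segment_region:
  assumes "k < 7" "i < 16" "j < 19" and z: "z \<in> closed_segment (position (node k i)) (position (node k j))"
  shows "z \<in> region k \<or> node k j < 6 \<and> z = position (node k j)"
proof -
  obtain t where t: "0 \<le> t" "t \<le> 1"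
    "z = (1 - t) *\<^sub>R position (node k i) + t *\<^sub>R position (node k j)"
    using z unfolding closed_segment_def by blast
  show ?thesis
  proof (cases "t = 1")
    case True
    then have "z = position (node k j)" using t by simp
    then show ?thesis
      using inner_position_in_region[OF assms(1), of j] node_less_6_iff[OF assms(1,3)] not_le by blast
  next
    case False
    let ?p = "real_point (cell_point i)" and ?q = "real_point (cell_point j)"
    let ?w = "(1 - t) *\<^sub>R ?p + t *\<^sub>R ?q"
    have "i < 19" using assms(2) by simp
    have z: "z = place k ?w"
      unfolding t(3) position_node[OF assms(1) \<open>i < 19\<close>] position_node[OF assms(1,3)] place_combination ..
    have p: "0 < fst ?p" "0 < snd ?p" "0 < 18 - (fst ?p + snd ?p)"
      using cell_point_interior[OF assms(2)] by simp_all
    have q: "0 \<le> fst ?q" "0 \<le> snd ?q" "0 \<le> 18 - (fst ?q + snd ?q)"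
      using cell_point_triangle[OF assms(3)] by simp_all
    have pos: "0 < (1 - t) * a + t * b" if "0 < a" "0 \<le> b" for a b
      using that t(1,2) False by (intro add_pos_nonneg mult_pos_pos mult_nonneg_nonneg) auto
    have "0 < fst ?w" "0 < snd ?w"
      using pos[OF p(1) q(1)] pos[OF p(2) q(2)] by simp_all
    moreover have "fst ?w + snd ?w < 18"
      using pos[OF p(3) q(3)] by (simp add: algebra_simps)
    ultimately have "place k (fst ?w, snd ?w) \<in> region k"
      by (rule place_in_region[OF assms(1)])
    then show ?thesis
      unfolding z prod.collapse by blast
  qed
qed

lemma frame_segments_meet:
  assumes "(u, v) \<in> set frame_edges" "(x, y) \<in> set frame_edges" "{u, v} \<noteq> {x, y}"
  shows "closed_segment (position u) (position v) \<inter> closed_segment (position x) (position y)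
    \<subseteq> position ` ({u, v} \<inter> {x, y})"
proof -
  have "segments_meet_properly (\<lambda>v. real_point (frame_point v)) (u, v) (x, y)"
    unfolding segments_meet_properly_real_point by (rule frame_segments_meet_properly[OF assms(1,2)])
  from segments_meet_properlyD[OF this assms(3)] show ?thesis
    using frame_edges_less[OF assms(1)] frame_edges_less[OF assms(2)]
    by (auto simp: position_def)
qed

text \<open>Applied to a corner of a cell: such a point can lie on an edge of the frame only as one of its ends.\<close>

lemma frame_vertex_on_segment:
  assumes "(u, v) \<in> set frame_edges" "b < 6" "position b \<in> closed_segment (position u) (position v)"
  shows "b \<in> {u, v}"
proof (rule ccontr)
  assume b: "b \<notin> {u, v}"
  obtain x y where xy: "(x, y) \<in> set frame_edges" "b = x \<or> b = y"
    by (rule frame_vertex_edge[OF assms(2)])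
  then have "position b \<in> closed_segment (position u) (position v) \<inter> closed_segment (position x) (position y)"
    using assms(3) by auto
  then have "position b \<in> position ` ({u, v} \<inter> {x, y})"
    using frame_segments_meet[OF assms(1) xy(1)] b xy(2) by blast
  then obtain c where "c \<in> {u, v}" "position b = position c" by blast
  then show False
    using inj_onD[OF inj_on_position, of b c] b assms(2) frame_edges_less[OF assms(1)] by auto
qed

lemma edges_cases:
  assumes "(u, v) \<in> edges"
  obtains "(u, v) \<in> set frame_edges"
    | k i j where "k < 7" "(i, j) \<in> set cell_edges" "u = node k i" "v = node k j" "i < 16" "j < 19"
  using assms cell_edges_less unfolding edges_def by blast

lemma cell_frame_segments_meet:
  assumes k: "k < 7" and ij: "i < 16" "j < 19" and uv: "(u, v) \<in> set frame_edges"
  shows "closed_segment (position (node k i)) (position (node k j)) \<inter>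
      closed_segment (position u) (position v) \<subseteq> position ` ({node k i, node k j} \<inter> {u, v})"
proof
  fix z
  assume z: "z \<in> closed_segment (position (node k i)) (position (node k j)) \<inter>
    closed_segment (position u) (position v)"
  then have "z \<notin> region k"
    using frame_segment_not_region[OF uv k] frame_edges_less[OF uv] by (simp add: position_def)
  then have "node k j < 6" "z = position (node k j)"
    using cell_segment_region[OF k ij, of z] z by blast+
  then show "z \<in> position ` ({node k i, node k j} \<inter> {u, v})"
    using frame_vertex_on_segment[OF uv] z by blast
qed

lemma edge_segments_meet:
  assumes uv: "(u, v) \<in> edges" and xy: "(x, y) \<in> edges" and neq: "{u, v} \<noteq> {x, y}"
  shows "closed_segment (position u) (position v) \<inter> closed_segment (position x) (position y)
    \<subseteq> position ` ({u, v} \<inter> {x, y})"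
  using uv
proof (cases rule: edges_cases)
  case frame: 1
  from xy show ?thesis
  proof (cases rule: edges_cases)
    case 1
    then show ?thesis using frame frame_segments_meet neq by blast
  next
    case (2 k i j)
    then show ?thesis
      using cell_frame_segments_meet[OF 2(1,5,6) frame] by (simp add: Int_commute del: node_simps)
  qed
next
  case uv: (2 k i j)
  from xy show ?thesis
  proof (cases rule: edges_cases)
    case 1
    then show ?thesis
      using cell_frame_segments_meet[OF uv(1,5,6) 1] uv by (simp del: node_simps)
  next
    case xy: (2 k' i' j')
    show ?thesis
    proof
      fix z
      assume "z \<in> closed_segment (position u) (position v) \<inter> closed_segment (position x) (position y)"
      then have zuv: "z \<in> closed_segment (position (node k i)) (position (node k j))"
        and zxy: "z \<in> closed_segment (position (node k' i')) (position (node k' j'))"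
        using uv xy by simp_all
      show "z \<in> position ` ({u, v} \<inter> {x, y})"
      proof (cases "k = k'")
        case True
        have lt: "i < 19" "i' < 19" using uv(5) xy(5) by simp_all
        obtain w where w: "z = place k w"
          "w \<in> closed_segment (real_point (cell_point i)) (real_point (cell_point j))"
          using cell_segment_image[OF uv(1) lt(1) uv(6) zuv] by blast
        obtain w' where w': "z = place k w'"
          "w' \<in> closed_segment (real_point (cell_point i')) (real_point (cell_point j'))"
          using cell_segment_image[OF xy(1) lt(2) xy(6) zxy] True by blast
        have "w = w'"
          using inj_place[OF uv(1)] w(1) w'(1) by simp
        have meet: "segments_meet_properly (\<lambda>v. real_point (cell_point v)) (i, j) (i', j')"
          unfolding segments_meet_properly_real_point
          by (rule cell_segments_meet_properly[OF uv(2) xy(2)])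
        have "{i, j} \<noteq> {i', j'}"
          using neq uv(3,4) xy(3,4) True by (metis image_empty image_insert)
        from segments_meet_properlyD[OF meet this]
        have "w \<in> (\<lambda>v. real_point (cell_point v)) ` ({i, j} \<inter> {i', j'})"
          by (rule subsetD) (use w(2) w'(2) \<open>w = w'\<close> in simp)
        then obtain l where l: "l \<in> {i, j}" "l \<in> {i', j'}" "w = real_point (cell_point l)"
          by blast
        then have "l < 19" using lt uv(6) by auto
        then have "z = position (node k l)"
          using position_node[OF uv(1)] w(1) l(3) by simp
        moreover have "node k l \<in> {u, v} \<inter> {x, y}"
          using l uv(3,4) xy(3,4) True by auto
        ultimately show ?thesis by blast
      next
        case False
        have a: "z \<in> region k \<or> node k j < 6 \<and> z = position (node k j)"
          by (rule cell_segment_region[OF uv(1,5,6) zuv])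
        have b: "z \<in> region k' \<or> node k' j' < 6 \<and> z = position (node k' j')"
          by (rule cell_segment_region[OF xy(1,5,6) zxy])
        have "z \<notin> region k" "z \<notin> region k'"
          using a b regions_disjoint[OF uv(1) xy(1)] False frame_point_not_region uv(1) xy(1) by blast+
        then have "node k j < 6" "node k' j' < 6" "z = position (node k j)" "z = position (node k' j')"
          using a b by auto
        moreover from this have "node k j = node k' j'"
          using inj_onD[OF inj_on_position, of "node k j" "node k' j'"] by simp
        ultimately show ?thesis
          using uv(4) xy(4) by simp
      qed
    qed
  qed
qed

lemma planar_spider_graph: "planar spider_graph"
proof (rule planar_straight_line[OF pair_graph_spider_graph])
  show "inj_on position (pverts spider_graph)"
    using inj_on_position by (simp add: spider_graph_def)
  show "\<exists>w. (v, w) \<in> parcs spider_graph" if "v \<in> pverts spider_graph" for v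
  proof -
    have "v < 118" using that by (simp add: spider_graph_def)
    then show ?thesis
    proof (cases rule: vertex_cases)
      case 1
      obtain x y where "(x, y) \<in> set frame_edges" "v = x \<or> v = y"
        by (rule frame_vertex_edge[OF 1])
      then show ?thesis
        by (auto simp: spider_graph_def edges_def)
    next
      case (2 k j)
      have "\<forall>j \<in> set [0..<16]. cell_adj j \<noteq> []"
        by code_simp
      then obtain i where "i \<in> set (cell_adj j)"
        using 2(2) by (metis atLeast_upt lessThan_iff list.set_sel(1))
      then show ?thesis
        using arcs_node[OF 2(1,2)] 2(3) by blast
    qed
  qed
  show "closed_segment (position u) (position v) \<inter> closed_segment (position x) (position y)
      \<subseteq> position ` ({u, v} \<inter> {x, y})"
    if "(u, v) \<in> parcs spider_graph" "(x, y) \<in> parcs spider_graph" "{u, v} \<noteq> {x, y}" for u v x y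
  proof -
    have "(u, v) \<in> edges \<or> (v, u) \<in> edges" "(x, y) \<in> edges \<or> (y, x) \<in> edges"
      using that by (auto simp: spider_graph_def)
    then show ?thesis
      using edge_segments_meet[of u v x y] edge_segments_meet[of v u x y] edge_segments_meet[of u v y x]
        edge_segments_meet[of v u y x] that(3)
      by (auto simp: closed_segment_commute insert_commute)
  qed
qed

section \<open>The counterexample\<close>

theorem mainTheorem1:
  shows "\<exists>G :: nat pair_pre_digraph.
    pair_graph G \<and> k_connected 3 G \<and> planar G \<and> \<not> prism_hamiltonian G"
  using pair_graph_spider_graph k_connected_spider_graph planar_spider_graph
    not_prism_hamiltonian_spider_graph by blast

end
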